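(* Let $(\mathcal X,\rho)$ be a Polish space and $\mu\in P_2(\mathcal X)$ such that \[\forall k\in\mathbf R,\ \forall u\ne v\in\mathcal X,\qquad \mu\{x\in\mathcal X:\rho^2(x,u)-\rho^2(x,v)=k\}=0.\] If $\mu$ satisfies $\mathbf{LSI}(C)$, then $\mu$ satisfies $\mathbf T_2(2C)$.
   Context: $\mathcal T_2(\nu,\mu)=\inf_\pi\int\rho(x,y)^2d\pi$ over couplings $\pi$ of $\nu,\mu$; $H(\nu\,|\,\mu)=\int\log\frac{d\nu}{d\mu}d\nu$ if $\nu\ll\mu$, else $+\infty$. $\mu$ satisfies $\mathbf T_2(C)$ if $\mathcal T_2(\nu,\mu)\le C\,H(\nu\,|\,\mu)$ for all probability measures $\nu$. $|\nabla f|(x)=\limsup_{y\to x}|f(x)-f(y)|/\rho(x,y)$ ($0$ at isolated points). $\mu$ satisfies $\mathbf{LSI}(C)$ if $\mathrm{Ent}_\mu(f^2)\le C\int|\nabla f|^2d\mu$ for all locally Lipschitz $f$, with $\mathrm{Ent}_\mu(g)=\int g\log g\,d\mu-\int g\,d\mu\log\int g\,d\mu$. *)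

theory Defs
  imports "HOL-Probability.Probability"
begin

definition couplings :: "'a::polish_space measure \<Rightarrow> 'a measure \<Rightarrow> ('a \<times> 'a) measure set" where
  "couplings \<nu> \<mu> = {\<pi>. prob_space \<pi> \<and> sets \<pi> = sets (borel \<Otimes>\<^sub>M borel)
        \<and> distr \<pi> borel fst = \<nu> \<and> distr \<pi> borel snd = \<mu>}"

definition transport_cost2 :: "'a::polish_space measure \<Rightarrow> 'a measure \<Rightarrow> ennreal" where
  "transport_cost2 \<nu> \<mu> =
     (\<Sqinter>\<pi>\<in>couplings \<nu> \<mu>. \<integral>\<^sup>+ p. ennreal ((dist (fst p) (snd p))\<^sup>2) \<partial>\<pi>)"

text \<open>Relative entropy H(nu | mu) = integral of log (d nu / d mu) d nu if nu << mu, else +infinity.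
  If the integrand is not nu-integrable, its negative part being always integrable,
  the integral is +infinity.\<close>
definition rel_entropy :: "'a measure \<Rightarrow> 'a measure \<Rightarrow> ereal" where
  "rel_entropy \<nu> \<mu> =
     (if sets \<nu> = sets \<mu> \<and> absolutely_continuous \<mu> \<nu> then
        (if integrable \<nu> (\<lambda>x. ln (enn2real (RN_deriv \<mu> \<nu> x)))
         then ereal (\<integral>x. ln (enn2real (RN_deriv \<mu> \<nu> x)) \<partial>\<nu>)
         else \<infinity>)
      else \<infinity>)"

definition satisfies_T2 :: "real \<Rightarrow> 'a::polish_space measure \<Rightarrow> bool" where
  "satisfies_T2 C \<mu> \<longleftrightarrow>
     (\<forall>\<nu>. prob_space \<nu> \<and> sets \<nu> = sets borel \<longrightarrow>
        enn2ereal (transport_cost2 \<nu> \<mu>) \<le> ereal C * rel_entropy \<nu> \<mu>)"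

definition slope :: "('a::metric_space \<Rightarrow> real) \<Rightarrow> 'a \<Rightarrow> ereal" where
  "slope f x = (if at x = bot then 0
                else Limsup (at x) (\<lambda>y. ereal (\<bar>f x - f y\<bar> / dist x y)))"

definition locally_lipschitz :: "('a::metric_space \<Rightarrow> real) \<Rightarrow> bool" where
  "locally_lipschitz f \<longleftrightarrow>
     (\<forall>x. \<exists>e>0. \<exists>L. \<forall>y\<in>ball x e. \<forall>z\<in>ball x e. \<bar>f y - f z\<bar> \<le> L * dist y z)"

definition xlogx :: "real \<Rightarrow> real" where
  "xlogx t = (if t = 0 then 0 else t * ln t)"

text \<open>Ent_mu(g) = int g log g - (int g) log (int g), for g \<ge> 0 integrable;
  the first integral is taken to be +infinity if g log g is not integrable
  (its negative part is bounded, so this is the only way it can fail).\<close>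
definition Ent :: "'a measure \<Rightarrow> ('a \<Rightarrow> real) \<Rightarrow> ereal" where
  "Ent \<mu> g = (if integrable \<mu> (\<lambda>x. xlogx (g x))
               then ereal ((\<integral>x. xlogx (g x) \<partial>\<mu>) - xlogx (\<integral>x. g x \<partial>\<mu>))
               else \<infinity>)"

text \<open>mu satisfies LSI(C): Ent_mu(f^2) \<le> C int |grad f|^2 d mu for all locally Lipschitz f
  (with f^2 integrable, so that Ent_mu(f^2) is defined).\<close>
definition satisfies_LSI :: "real \<Rightarrow> 'a::metric_space measure \<Rightarrow> bool" where
  "satisfies_LSI C \<mu> \<longleftrightarrow>
     (\<forall>f. locally_lipschitz f \<and> integrable \<mu> (\<lambda>x. (f x)\<^sup>2) \<longrightarrow>
        Ent \<mu> (\<lambda>x. (f x)\<^sup>2) \<le> ereal C * enn2ereal (\<integral>\<^sup>+ x. ennreal ((real_of_ereal (slope f x))\<^sup>2) \<partial>\<mu>))"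

end

theory Submission
  imports Defs
begin

text \<open>The sharp implication from LSI(C) to T2(C) holds on every Polish space, by the Hamilton-Jacobi argument
  of Bobkov, Gentil and Ledoux. For bounded f let R s x be the infimum over y of f y + s d(x,y)^2. In any metric
  space, |grad (R s)|^2 is at most 4 s^2 (R s - R r) / (s - r) for all r < s, which replaces the Hamilton-Jacobi
  equation and needs no differentiability in s. Inserting exp (R s / (2 C s)) into LSI(C) shows that
  C s log (int exp (R s / (C s)) d mu) is nondecreasing in s, up to errors that vanish when a discretisation in s
  is refined. Between s = 1 and s = infinity this gives C log (int exp (R 1 / C) d mu) <= int f d mu, and the
  variational inequality for the entropy turns it into int R 1 d nu - int f d mu <= C H(nu|mu).
  The passage to couplings is an approximate Kantorovich duality: both measures are quantized to finitely many
  points at small quadratic cost, the finite problem is solved with the Farkas lemma, and the finite plan is lifted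
  to a density with respect to the product of the two measures.\<close>

section \<open>Infimal convolution with the squared distance\<close>

text \<open>The exponent comes from differentiating
  \<open>C s log (int exp (R s / (C s)) d mu)\<close> formally in s. Write theta = 1 / (C s), E =
  exp (theta R s), Z = int E d mu, and R' for the derivative of R s in s. The derivative is (C / Z)
  times ((1 / C) int R' E d mu - Ent E). LSI for exp (theta R s / 2) bounds Ent E by (C theta^2 / 4)
  int |grad R s|^2 E d mu, and the slope bound turns this into C theta^2 s^2 int R' E d mu = (1 / C)
  int R' E d mu. The factors 1 / 4 and 4 cancel, and the derivative is nonnegative with no loss in
  the constant. At s = infinity only R s <= f enters, never the convergence of R s to f, so f can be
  any bounded Borel function. The duality argument relies on this freedom: its test functions are
  assembled from values on the cells of a quantization and are in general discontinuous.\<close>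

text \<open>This is the Hopf-Lax formula with time 1 / (2 s), so increasing \<open>s\<close> runs
  time backwards. The real-valued \<open>INF\<close> is meaningful only when the set is bounded
  below, which boundedness of \<open>f\<close> and \<open>s \<ge> 0\<close> ensure.\<close>

definition inf_conv :: "real \<Rightarrow> ('a::metric_space \<Rightarrow> real) \<Rightarrow> 'a \<Rightarrow> real" where
  "inf_conv s f x = (INF y. f y + s * (dist x y)\<^sup>2)"

lemma inf_conv_greatest:
  assumes "\<And>y. c \<le> f y + s * (dist x y)\<^sup>2"
  shows "c \<le> inf_conv s f x"
  unfolding inf_conv_def by (rule cINF_greatest) (use assms in auto)

lemma inf_conv_almost_attained:
  assumes "\<eta> > 0"
  obtains z where "f z + s * (dist x z)\<^sup>2 < inf_conv s f x + \<eta>"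
proof (rule ccontr)
  assume "\<not> thesis"
  then have "inf_conv s f x + \<eta> \<le> f z + s * (dist x z)\<^sup>2" for z
    using that not_less by blast
  then have "inf_conv s f x + \<eta> \<le> inf_conv s f x" by (rule inf_conv_greatest)
  then show False using assms by simp
qed

context
  fixes f :: "'a::metric_space \<Rightarrow> real" and M :: real
  assumes f_bounded: "\<And>x. \<bar>f x\<bar> \<le> M"
begin

lemma inf_conv_le:
  assumes "s \<ge> 0"
  shows "inf_conv s f x \<le> f y + s * (dist x y)\<^sup>2"
  unfolding inf_conv_def
proof (rule cINF_lower)
  have "- M \<le> f z + s * (dist x z)\<^sup>2" for z
    using f_bounded[of z] assms by (smt (verit) mult_nonneg_nonneg zero_le_power2)
  then show "bdd_below (range (\<lambda>y. f y + s * (dist x y)\<^sup>2))"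
    by (intro bdd_belowI2)
qed simp

lemma inf_conv_le_self: "s \<ge> 0 \<Longrightarrow> inf_conv s f x \<le> f x"
  using inf_conv_le[of s x x] by simp

lemma inf_conv_bounded:
  assumes "s \<ge> 0"
  shows "\<bar>inf_conv s f x\<bar> \<le> M"
proof -
  have "- M \<le> f y + s * (dist x y)\<^sup>2" for y
    using f_bounded[of y] assms by (smt (verit) mult_nonneg_nonneg zero_le_power2)
  then have "- M \<le> inf_conv s f x" by (rule inf_conv_greatest)
  then show ?thesis using inf_conv_le_self[OF assms, of x] f_bounded[of x] by linarith
qed

lemma inf_conv_mono:
  assumes "0 \<le> r" "r \<le> s"
  shows "inf_conv r f x \<le> inf_conv s f x"
proof (rule inf_conv_greatest)
  fix y
  have "r * (dist x y)\<^sup>2 \<le> s * (dist x y)\<^sup>2" using assms by (intro mult_right_mono) auto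
  then show "inf_conv r f x \<le> f y + s * (dist x y)\<^sup>2"
    using inf_conv_le[of r x y] assms by linarith
qed

text \<open>A near-minimiser at \<open>r\<close> is a competitor at \<open>s\<close>, and
  boundedness of \<open>f\<close> keeps its squared distance from \<open>x\<close> below about
  \<open>2 * M / r\<close>. This makes the difference quotient in the parameter bounded uniformly in
  \<open>x\<close>, which later gives integrability and uniform errors.\<close>

lemma inf_conv_increment_le:
  assumes "0 < r" "r \<le> s"
  shows "inf_conv s f x - inf_conv r f x \<le> (s - r) * (2 * M / r)"
proof (rule field_le_epsilon)
  fix \<epsilon> :: real assume "\<epsilon> > 0"
  \<comment> \<open>The tolerance enters once through the near-minimum and once, multiplied by
    \<open>(s - r) / r\<close>, through the distance bound; the total is
    \<open>\<eta> * (s / r)\<close>.\<close>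
  define \<eta> where "\<eta> = \<epsilon> / (s / r)"
  have \<eta>: "\<eta> > 0" "\<eta> * (s / r) = \<epsilon>" using \<open>\<epsilon> > 0\<close> assms unfolding \<eta>_def by (auto simp: field_simps)
  obtain z where z: "f z + r * (dist x z)\<^sup>2 < inf_conv r f x + \<eta>"
    using inf_conv_almost_attained[OF \<eta>(1)] .
  have "r * (dist x z)\<^sup>2 \<le> 2 * M + \<eta>"
    using z f_bounded[of z] inf_conv_bounded[of r x] assms by linarith
  then have d: "(dist x z)\<^sup>2 \<le> (2 * M + \<eta>) / r" using assms by (simp add: field_simps)
  have "inf_conv s f x - inf_conv r f x \<le> (s - r) * (dist x z)\<^sup>2 + \<eta>"
    using inf_conv_le[of s x z] z assms by (simp add: algebra_simps)
  also have "\<dots> \<le> (s - r) * ((2 * M + \<eta>) / r) + \<eta>"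
    using d assms by (intro add_mono mult_left_mono) auto
  also have "\<dots> = (s - r) * (2 * M / r) + \<eta> * (s / r)"
    using assms by (simp add: field_simps)
  finally show "inf_conv s f x - inf_conv r f x \<le> (s - r) * (2 * M / r) + \<epsilon>"
    using \<eta>(2) by simp
qed

text \<open>A near-minimiser z at parameter s is a competitor at the smaller parameter r, which bounds
  the squared distance from x to z by the difference quotient in the parameter.\<close>
lemma inf_conv_diff_le:
  assumes "0 \<le> r" "r < s"
  shows "inf_conv s f y - inf_conv s f x
           \<le> s * dist x y * (dist x y + 2 * sqrt ((inf_conv s f x - inf_conv r f x) / (s - r)))"
proof -
  \<comment> \<open>The infimum need not be attained, so the bound is proved with a tolerance
    \<open>\<eta>\<close> and then passes to the limit at 0.\<close>
  define G where "G \<eta> = s * dist x y * (dist x y + 2 * sqrt ((inf_conv s f x - inf_conv r f x + \<eta>) / (s - r))) + \<eta>" for \<eta>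
  have "inf_conv s f y - inf_conv s f x \<le> G \<eta>" if \<eta>: "\<eta> > 0" for \<eta>
  proof -
    obtain z where z: "f z + s * (dist x z)\<^sup>2 < inf_conv s f x + \<eta>"
      using inf_conv_almost_attained[OF \<eta>] .
    have "(s - r) * (dist x z)\<^sup>2 \<le> inf_conv s f x - inf_conv r f x + \<eta>"
      using inf_conv_le[of r x z] z assms by (simp add: algebra_simps)
    then have "(dist x z)\<^sup>2 \<le> (inf_conv s f x - inf_conv r f x + \<eta>) / (s - r)"
      using assms by (simp add: field_simps)
    then have d: "dist x z \<le> sqrt ((inf_conv s f x - inf_conv r f x + \<eta>) / (s - r))"
      by (rule real_le_rsqrt)
    have "(dist y z)\<^sup>2 \<le> (dist x y + dist x z)\<^sup>2"
      by (intro power_mono) (metis dist_commute dist_triangle, simp)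
    then have "(dist y z)\<^sup>2 - (dist x z)\<^sup>2 \<le> dist x y * (dist x y + 2 * dist x z)"
      by (simp add: power2_eq_square algebra_simps)
    also have "\<dots> \<le> dist x y * (dist x y + 2 * sqrt ((inf_conv s f x - inf_conv r f x + \<eta>) / (s - r)))"
      using d by (intro mult_left_mono) auto
    finally have "s * ((dist y z)\<^sup>2 - (dist x z)\<^sup>2) \<le> s * (dist x y * (dist x y + 2 * sqrt ((inf_conv s f x - inf_conv r f x + \<eta>) / (s - r))))"
      using assms by (intro mult_left_mono) auto
    then show ?thesis
      using inf_conv_le[of s y z] z assms unfolding G_def by (simp add: algebra_simps)
  qed
  moreover have "(G \<longlongrightarrow> G 0) (at_right 0)"
    unfolding G_def by (intro tendsto_intros) (use assms in auto)
  ultimately have "inf_conv s f y - inf_conv s f x \<le> G 0"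
    by (intro tendsto_lowerbound[of G "G 0" "at_right 0"])
       (auto intro!: eventually_at_right_less[THEN eventually_mono])
  then show ?thesis by (simp add: G_def)
qed

text \<open>This is the preceding estimate at \<open>r = 0\<close>, where both values lie in
  [-M, M]. The modulus depends on \<open>f\<close> only through \<open>M\<close>, and gives
  continuity, hence Borel measurability, of the infimal convolution.\<close>

lemma inf_conv_lipschitz_scale:
  assumes "s > 0"
  shows "\<bar>inf_conv s f x - inf_conv s f y\<bar> \<le> s * dist x y * (dist x y + 2 * sqrt (2 * M / s))"
proof -
  have "inf_conv s f v - inf_conv s f u \<le> s * dist u v * (dist u v + 2 * sqrt (2 * M / s))" for u v
  proof -
    have "sqrt ((inf_conv s f u - inf_conv 0 f u) / (s - 0)) \<le> sqrt (2 * M / s)"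
      using inf_conv_bounded[of s u] inf_conv_bounded[of 0 u] assms
      by (intro real_sqrt_le_mono) (auto intro!: divide_right_mono)
    then have "s * dist u v * (dist u v + 2 * sqrt ((inf_conv s f u - inf_conv 0 f u) / (s - 0)))
        \<le> s * dist u v * (dist u v + 2 * sqrt (2 * M / s))"
      using assms by (intro mult_left_mono) auto
    then show ?thesis using inf_conv_diff_le[of 0 s v u] assms by linarith
  qed
  from this[of x y] this[of y x] show ?thesis by (simp add: dist_commute abs_le_iff)
qed

lemma inf_conv_continuous:
  assumes "s > 0"
  shows "continuous_on UNIV (inf_conv s f)"
proof -
  have "(inf_conv s f \<longlongrightarrow> inf_conv s f x) (at x)" for x
  proof (rule Lim_null_comparison[THEN Lim_null[THEN iffD2]])
    show "\<forall>\<^sub>F y in at x. norm (inf_conv s f y - inf_conv s f x) \<le> s * dist x y * (dist x y + 2 * sqrt (2 * M / s))"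
      using inf_conv_lipschitz_scale[OF assms, of x] by (simp add: abs_minus_commute)
    have "((\<lambda>y. s * dist x y * (dist x y + 2 * sqrt (2 * M / s))) \<longlongrightarrow> s * dist x x * (dist x x + 2 * sqrt (2 * M / s))) (at x)"
      by (intro tendsto_intros)
    then show "((\<lambda>y. s * dist x y * (dist x y + 2 * sqrt (2 * M / s))) \<longlongrightarrow> 0) (at x)" by simp
  qed
  then show ?thesis by (simp add: continuous_on_def)
qed

lemma inf_conv_measurable [measurable]:
  assumes "s > 0"
  shows "inf_conv s f \<in> borel_measurable borel"
  using inf_conv_continuous[OF assms] by (rule borel_measurable_continuous_onI)

end

section \<open>Slopes of exponentials of infimal convolutions\<close>

lemma slope_nonneg: "slope f x \<ge> 0"
proof (cases "at x = bot")
  case False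
  then show ?thesis unfolding slope_def
    by (auto intro!: le_Limsup)
qed (simp add: slope_def)

text \<open>The Lipschitz factor \<open>B y\<close> may vary with \<open>y\<close>, so a bound
  symmetric in the two points collapses to its value at \<open>x\<close> in the limit. The condition
  \<open>0 \<le> b\<close> covers isolated points, where the slope is 0.\<close>

lemma real_slope_le:
  assumes "\<And>y. \<bar>F x - F y\<bar> \<le> B y * dist x y" "(B \<longlongrightarrow> b) (at x)" "0 \<le> b"
  shows "real_of_ereal (slope F x) \<le> b"
proof -
  have "slope F x \<le> ereal b"
  proof (cases "at x = bot")
    case False
    have "Limsup (at x) (\<lambda>y. ereal (\<bar>F x - F y\<bar> / dist x y)) \<le> Limsup (at x) (\<lambda>y. ereal (B y))"
    proof (rule Limsup_mono)
      show "\<forall>\<^sub>F y in at x. ereal (\<bar>F x - F y\<bar> / dist x y) \<le> ereal (B y)"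
        unfolding eventually_at_filter
        by (rule always_eventually) (use assms(1) in \<open>auto simp: divide_le_eq\<close>)
    qed
    also have "\<dots> = ereal b"
      using False assms(2) by (intro lim_imp_Limsup) (auto)
    finally show ?thesis using False by (simp add: slope_def)
  qed (use assms(3) in \<open>simp add: slope_def\<close>)
  then show ?thesis using slope_nonneg[of F x] assms(3)
    by (cases "slope F x") auto
qed

lemma exp_diff_le: "\<bar>exp a - exp b\<bar> \<le> exp (max a b) * \<bar>a - (b::real)\<bar>"
proof -
  have "exp v - exp u \<le> exp v * (v - u)" if "u \<le> v" for u v :: real
  proof -
    have "1 + (u - v) \<le> exp (u - v)" by (rule exp_ge_add_one_self)
    then have "exp v * (1 + (u - v)) \<le> exp v * exp (u - v)" by (intro mult_left_mono) auto
    then show ?thesis by (simp add: exp_add[symmetric] algebra_simps)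
  qed
  from this[of a b] this[of b a] show ?thesis by (cases "a \<le> b") (auto simp: max_def)
qed

text \<open>The one-sided estimate \<open>inf_conv_diff_le\<close> is used from \<open>x\<close> to
  \<open>y\<close> and from \<open>y\<close> to \<open>x\<close>, with the difference quotients at
  the two base points. For \<open>r > 0\<close> these quotients are continuous in the point, so near
  \<open>x\<close> both tend to the one at \<open>x\<close>.\<close>

lemma slope_exp_inf_conv_le:
  fixes f :: "'a::metric_space \<Rightarrow> real"
  assumes f: "\<And>x. \<bar>f x\<bar> \<le> M" and r: "0 < r" "r < s" and "\<kappa> \<ge> 0"
  shows "real_of_ereal (slope (\<lambda>x. exp (\<kappa> * inf_conv s f x)) x)
    \<le> 2 * s * \<kappa> * exp (\<kappa> * inf_conv s f x) * sqrt ((inf_conv s f x - inf_conv r f x) / (s - r))"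
proof -
  define U where "U y = (inf_conv s f y - inf_conv r f y) / (s - r)" for y
  \<comment> \<open>The two maxima make the bound valid for both signs of the increment; at
    \<open>y = x\<close> they collapse and the distance term vanishes.\<close>
  define B where "B y = exp (max (\<kappa> * inf_conv s f x) (\<kappa> * inf_conv s f y))
      * (\<kappa> * (s * (dist x y + 2 * sqrt (max (U x) (U y)))))" for y
  have s: "s > 0" using r by simp
  have lim: "(inf_conv t f \<longlongrightarrow> inf_conv t f x) (at x)" if "t > 0" for t
    using inf_conv_continuous[of f M t, OF f that] unfolding continuous_on_def by simp
  have d: "\<bar>inf_conv s f x - inf_conv s f y\<bar> \<le> s * dist x y * (dist x y + 2 * sqrt (max (U x) (U y)))" for y
  proof -
    have "inf_conv s f v - inf_conv s f u \<le> s * dist u v * (dist u v + 2 * sqrt (max (U u) (U v)))" for u v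
    proof -
      have "s * dist u v * (dist u v + 2 * sqrt (U u)) \<le> s * dist u v * (dist u v + 2 * sqrt (max (U u) (U v)))"
        using s by (intro mult_left_mono) auto
      then show ?thesis using inf_conv_diff_le[of f M r s v u, OF f] r unfolding U_def by linarith
    qed
    from this[of x y] this[of y x] show ?thesis by (simp add: dist_commute abs_le_iff max.commute)
  qed
  have "real_of_ereal (slope (\<lambda>x. exp (\<kappa> * inf_conv s f x)) x) \<le> B x"
  proof (rule real_slope_le)
    show "\<bar>exp (\<kappa> * inf_conv s f x) - exp (\<kappa> * inf_conv s f y)\<bar> \<le> B y * dist x y" for y
    proof -
      have "\<bar>\<kappa> * inf_conv s f x - \<kappa> * inf_conv s f y\<bar> = \<kappa> * \<bar>inf_conv s f x - inf_conv s f y\<bar>"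
        using \<open>\<kappa> \<ge> 0\<close> by (simp add: right_diff_distrib[symmetric] abs_mult)
      also have "\<dots> \<le> \<kappa> * (s * dist x y * (dist x y + 2 * sqrt (max (U x) (U y))))"
        using d \<open>\<kappa> \<ge> 0\<close> by (rule mult_left_mono)
      finally have "exp (max (\<kappa> * inf_conv s f x) (\<kappa> * inf_conv s f y)) * \<bar>\<kappa> * inf_conv s f x - \<kappa> * inf_conv s f y\<bar>
         \<le> exp (max (\<kappa> * inf_conv s f x) (\<kappa> * inf_conv s f y)) * (\<kappa> * (s * dist x y * (dist x y + 2 * sqrt (max (U x) (U y)))))"
        by (rule mult_left_mono) simp
      with exp_diff_le have "\<bar>exp (\<kappa> * inf_conv s f x) - exp (\<kappa> * inf_conv s f y)\<bar>
         \<le> exp (max (\<kappa> * inf_conv s f x) (\<kappa> * inf_conv s f y)) * (\<kappa> * (s * dist x y * (dist x y + 2 * sqrt (max (U x) (U y)))))"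
        by (rule order_trans)
      then show ?thesis unfolding B_def by (simp add: mult_ac)
    qed
    show "(B \<longlongrightarrow> B x) (at x)"
      unfolding B_def U_def by (intro tendsto_intros lim) (use r in auto)
    have "U x \<ge> 0" using inf_conv_mono[of f M r s x] f r by (simp add: U_def)
    then show "0 \<le> B x" using s \<open>\<kappa> \<ge> 0\<close> by (simp add: B_def)
  qed
  then show ?thesis by (simp add: B_def U_def mult_ac)
qed

lemma locally_lipschitz_exp_inf_conv:
  fixes f :: "'a::metric_space \<Rightarrow> real"
  assumes f: "\<And>x. \<bar>f x\<bar> \<le> M" and "s > 0" "\<kappa> \<ge> 0"
  shows "locally_lipschitz (\<lambda>x. exp (\<kappa> * inf_conv s f x))"
  unfolding locally_lipschitz_def
proof (intro allI exI conjI ballI)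
  \<comment> \<open>Radius 1/2 forces \<open>dist y z \<le> 1\<close>, so the quadratic part of the
    modulus is absorbed into the linear one.\<close>
  fix x y z :: 'a assume yz: "y \<in> ball x (1/2)" "z \<in> ball x (1/2)"
  have "dist y z \<le> 1" using yz dist_triangle_half_l[of y x 1 z] by (auto simp: dist_commute less_imp_le)
  have "\<bar>\<kappa> * inf_conv s f y - \<kappa> * inf_conv s f z\<bar> = \<kappa> * \<bar>inf_conv s f y - inf_conv s f z\<bar>"
    using \<open>\<kappa> \<ge> 0\<close> by (simp add: right_diff_distrib[symmetric] abs_mult)
  also have "\<dots> \<le> \<kappa> * (s * dist y z * (dist y z + 2 * sqrt (2 * M / s)))"
    using inf_conv_lipschitz_scale[of f M s y z] assms by (intro mult_left_mono) auto
  also have "\<dots> \<le> \<kappa> * (s * dist y z * (1 + 2 * sqrt (2 * M / s)))"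
    using \<open>dist y z \<le> 1\<close> assms by (intro mult_left_mono) auto
  finally have 1: "\<bar>\<kappa> * inf_conv s f y - \<kappa> * inf_conv s f z\<bar> \<le> \<kappa> * (s * dist y z * (1 + 2 * sqrt (2 * M / s)))" .
  have "\<kappa> * inf_conv s f u \<le> \<kappa> * M" for u
    using inf_conv_bounded[of f M s u] assms by (intro mult_left_mono) auto
  then have "exp (max (\<kappa> * inf_conv s f y) (\<kappa> * inf_conv s f z)) \<le> exp (\<kappa> * M)" by simp
  then have "exp (max (\<kappa> * inf_conv s f y) (\<kappa> * inf_conv s f z)) * \<bar>\<kappa> * inf_conv s f y - \<kappa> * inf_conv s f z\<bar>
     \<le> exp (\<kappa> * M) * (\<kappa> * (s * dist y z * (1 + 2 * sqrt (2 * M / s))))"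
    using 1 by (intro mult_mono) auto
  with exp_diff_le have "\<bar>exp (\<kappa> * inf_conv s f y) - exp (\<kappa> * inf_conv s f z)\<bar>
     \<le> exp (\<kappa> * M) * (\<kappa> * (s * dist y z * (1 + 2 * sqrt (2 * M / s))))"
    by (rule order_trans)
  then show "\<bar>exp (\<kappa> * inf_conv s f y) - exp (\<kappa> * inf_conv s f z)\<bar>
      \<le> (exp (\<kappa> * M) * (\<kappa> * s * (1 + 2 * sqrt (2 * M / s)))) * dist y z"
    by (simp add: mult_ac)
qed simp

section \<open>Exponential moments under the logarithmic Sobolev inequality\<close>

lemma exp_le_one_plus_square:
  fixes w :: real
  assumes "\<bar>w\<bar> \<le> 1"
  shows "exp w \<le> 1 + w + w\<^sup>2"
proof (cases "w \<ge> 0")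
  case True
  then show ?thesis using exp_bound[of w] assms by simp
next
  case False
  have "(1 - w) * exp w \<le> exp (- w) * exp w"
    using exp_ge_add_one_self[of "- w"] by (intro mult_right_mono) auto
  then have 1: "(1 - w) * exp w \<le> 1" by (simp add: exp_minus)
  \<comment> \<open>For negative \<open>w\<close> both sides are compared after multiplication by
    \<open>1 - w > 0\<close>, where 1 separates them: the cubic remainder \<open>- w ^ 3\<close> is
    positive.\<close>
  have "(1 - w) * (1 + w + w\<^sup>2) = 1 + (- w) ^ 3"
    by (simp add: power2_eq_square power3_eq_cube algebra_simps)
  then have "(1 - w) * (1 + w + w\<^sup>2) \<ge> 1" using False by simp
  then have "(1 - w) * exp w \<le> (1 - w) * (1 + w + w\<^sup>2)" using 1 by linarith
  then show ?thesis using False by (simp add: mult_le_cancel_left)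
qed

lemma integrable_bounded_borel:
  fixes g :: "'a::topological_space \<Rightarrow> real"
  assumes "prob_space \<mu>" "sets \<mu> = sets borel" "g \<in> borel_measurable borel" "\<And>x. \<bar>g x\<bar> \<le> b"
  shows "integrable \<mu> g"
proof -
  interpret prob_space \<mu> by fact
  show ?thesis
    using assms by (intro integrable_const_bound[where B = b]) (auto cong: measurable_cong_sets)
qed

lemma xlogx_exp: "xlogx (exp t) = t * exp t"
  by (simp add: xlogx_def)

lemma satisfies_LSI_mono:
  assumes "satisfies_LSI C \<mu>" "C \<le> D"
  shows "satisfies_LSI D \<mu>"
  unfolding satisfies_LSI_def
proof (intro allI impI)
  fix f assume "locally_lipschitz f \<and> integrable \<mu> (\<lambda>x. (f x)\<^sup>2)"
  then have "Ent \<mu> (\<lambda>x. (f x)\<^sup>2)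
      \<le> ereal C * enn2ereal (\<integral>\<^sup>+ x. ennreal ((real_of_ereal (slope f x))\<^sup>2) \<partial>\<mu>)"
    using assms(1) by (simp add: satisfies_LSI_def)
  also have "\<dots> \<le> ereal D * enn2ereal (\<integral>\<^sup>+ x. ennreal ((real_of_ereal (slope f x))\<^sup>2) \<partial>\<mu>)"
    using assms(2) by (intro ereal_mult_right_mono) auto
  finally show "Ent \<mu> (\<lambda>x. (f x)\<^sup>2)
      \<le> ereal D * enn2ereal (\<integral>\<^sup>+ x. ennreal ((real_of_ereal (slope f x))\<^sup>2) \<partial>\<mu>)" .
qed

text \<open>LSI is applied to the square root of \<open>exp (\<theta> * inf_conv s f x)\<close>.
  Squaring the slope bound with \<open>\<kappa> = \<theta> / 2\<close> cancels its factor 2 and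
  leaves \<open>\<theta>\<^sup>2 * s\<^sup>2\<close> times the difference quotient.\<close>

lemma Ent_exp_inf_conv_le:
  fixes f :: "'a::metric_space \<Rightarrow> real"
  assumes \<mu>: "prob_space \<mu>" "sets \<mu> = sets borel" and "C > 0" and LSI: "satisfies_LSI C \<mu>"
    and f: "\<And>x. \<bar>f x\<bar> \<le> M" and r: "0 < r" "r < s" and "\<theta> \<ge> 0"
  defines "Z \<equiv> \<integral>x. exp (\<theta> * inf_conv s f x) \<partial>\<mu>"
  shows "\<theta> * (\<integral>x. inf_conv s f x * exp (\<theta> * inf_conv s f x) \<partial>\<mu>) - Z * ln Z
    \<le> C * \<theta>\<^sup>2 * s\<^sup>2 * (\<integral>x. (inf_conv s f x - inf_conv r f x) / (s - r) * exp (\<theta> * inf_conv s f x) \<partial>\<mu>)"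
proof -
  interpret prob_space \<mu> by fact
  define g where "g = inf_conv s f"
  define u where "u x = (inf_conv s f x - inf_conv r f x) / (s - r)" for x
  define F where "F x = exp ((\<theta> / 2) * g x)" for x
  have s: "s > 0" using r by simp
  have g: "\<bar>g x\<bar> \<le> M" for x using inf_conv_bounded[of f M s x] f s by (simp add: g_def)
  have M: "M \<ge> 0" using f[of undefined] by linarith
  have [measurable]: "g \<in> borel_measurable borel" "u \<in> borel_measurable borel"
    using inf_conv_measurable[of f M, OF f s] inf_conv_measurable[of f M, OF f r(1)]
    unfolding g_def u_def by simp_all
  have u0: "0 \<le> u x" for x
    using inf_conv_mono[of f M r s x] f r by (simp add: u_def)
  have "u x \<le> 2 * M / r" for x
    using inf_conv_increment_le[of f M r s x] f r by (simp add: u_def divide_le_eq mult.commute)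
  then have u: "\<bar>u x\<bar> \<le> 2 * M / r" for x using u0[of x] by simp
  have e: "exp (\<theta> * g x) \<le> exp (\<theta> * M)" for x
    using g[of x] \<open>\<theta> \<ge> 0\<close> by (simp add: mult_left_mono)
  have F2: "(F x)\<^sup>2 = exp (\<theta> * g x)" for x
    by (simp add: F_def power2_eq_square exp_add[symmetric])
  have int: "integrable \<mu> (\<lambda>x. k x * exp (\<theta> * g x))"
    if [measurable]: "k \<in> borel_measurable borel" and "\<And>x. \<bar>k x\<bar> \<le> b" for k b
  proof (rule integrable_bounded_borel[OF \<mu>])
    show "\<bar>k x * exp (\<theta> * g x)\<bar> \<le> b * exp (\<theta> * M)" for x
      unfolding abs_mult using that(2)[of x] e[of x] by (intro mult_mono) auto
  qed measurable
  have ent: "Ent \<mu> (\<lambda>x. (F x)\<^sup>2) \<le> ereal C * enn2ereal (\<integral>\<^sup>+ x. ennreal ((real_of_ereal (slope F x))\<^sup>2) \<partial>\<mu>)"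
  proof -
    have "locally_lipschitz F"
      unfolding F_def g_def using locally_lipschitz_exp_inf_conv[of f M s "\<theta> / 2"] f s \<open>\<theta> \<ge> 0\<close> by simp
    moreover have "integrable \<mu> (\<lambda>x. (F x)\<^sup>2)" unfolding F2 using int[of "\<lambda>_. 1" 1] by simp
    ultimately show ?thesis using LSI by (simp add: satisfies_LSI_def)
  qed
  have "(\<integral>\<^sup>+ x. ennreal ((real_of_ereal (slope F x))\<^sup>2) \<partial>\<mu>)
      \<le> (\<integral>\<^sup>+ x. ennreal (\<theta>\<^sup>2 * s\<^sup>2 * (u x * exp (\<theta> * g x))) \<partial>\<mu>)"
  proof (intro nn_integral_mono ennreal_leI)
    fix x
    have "real_of_ereal (slope F x) \<le> 2 * s * (\<theta> / 2) * exp ((\<theta> / 2) * g x) * sqrt (u x)"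
      using slope_exp_inf_conv_le[of f M r s "\<theta> / 2" x] f r \<open>\<theta> \<ge> 0\<close> unfolding F_def g_def u_def by simp
    then have "(real_of_ereal (slope F x))\<^sup>2 \<le> (s * \<theta> * F x * sqrt (u x))\<^sup>2"
      using real_of_ereal_pos[OF slope_nonneg[of F x]] by (intro power_mono) (auto simp: F_def)
    also have "\<dots> = \<theta>\<^sup>2 * s\<^sup>2 * (u x * exp (\<theta> * g x))"
      using u0[of x] by (simp add: power_mult_distrib F2)
    finally show "(real_of_ereal (slope F x))\<^sup>2 \<le> \<theta>\<^sup>2 * s\<^sup>2 * (u x * exp (\<theta> * g x))" .
  qed
  also have "\<dots> = ennreal (\<theta>\<^sup>2 * s\<^sup>2 * (\<integral>x. u x * exp (\<theta> * g x) \<partial>\<mu>))"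
    using u0 int[of u, OF _ u] by (subst nn_integral_eq_integral) (auto)
  finally have "enn2ereal (\<integral>\<^sup>+ x. ennreal ((real_of_ereal (slope F x))\<^sup>2) \<partial>\<mu>)
      \<le> enn2ereal (ennreal (\<theta>\<^sup>2 * s\<^sup>2 * (\<integral>x. u x * exp (\<theta> * g x) \<partial>\<mu>)))"
    by (simp only: less_eq_ennreal.rep_eq)
  then have "Ent \<mu> (\<lambda>x. (F x)\<^sup>2)
      \<le> ereal C * enn2ereal (ennreal (\<theta>\<^sup>2 * s\<^sup>2 * (\<integral>x. u x * exp (\<theta> * g x) \<partial>\<mu>)))"
    using \<open>C > 0\<close> by (intro order_trans[OF ent] ereal_mult_left_mono) auto
  then have "Ent \<mu> (\<lambda>x. (F x)\<^sup>2) \<le> ereal C * ereal (\<theta>\<^sup>2 * s\<^sup>2 * (\<integral>x. u x * exp (\<theta> * g x) \<partial>\<mu>))"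
    using u0 by (simp add: enn2ereal_ennreal)
  moreover have "Ent \<mu> (\<lambda>x. (F x)\<^sup>2) = ereal (\<theta> * (\<integral>x. g x * exp (\<theta> * g x) \<partial>\<mu>) - Z * ln Z)"
  proof -
    have "Z \<ge> exp (\<theta> * - M)"
    proof -
      have "exp (\<theta> * - M) = (\<integral>x. exp (\<theta> * - M) \<partial>\<mu>)" by (simp add: prob_space)
      also have "\<dots> \<le> Z" unfolding Z_def
      proof (rule integral_mono)
        show "exp (\<theta> * - M) \<le> exp (\<theta> * inf_conv s f x)" for x
          using g[of x] \<open>\<theta> \<ge> 0\<close> unfolding g_def exp_le_cancel_iff by (intro mult_left_mono) auto
      qed (use int[of "\<lambda>_. 1" 1] in \<open>simp_all add: g_def\<close>)
      finally show ?thesis .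
    qed
    then have "Z > 0" using exp_gt_zero[of "\<theta> * - M"] by linarith
    then show ?thesis
      unfolding Ent_def F2 xlogx_exp using int[OF \<open>g \<in> borel_measurable borel\<close> g]
      by (simp add: mult.assoc xlogx_def Z_def g_def)
  qed
  ultimately show ?thesis by (simp add: g_def u_def mult.assoc)
qed

text \<open>To first order in s - r, the change of the exponent from s to r contributes exactly the terms that
  LSI controls through the slope bound, so that only a quadratic error remains.\<close>
lemma log_exp_moment_step:
  fixes f :: "'a::metric_space \<Rightarrow> real"
  assumes \<mu>: "prob_space \<mu>" "sets \<mu> = sets borel" and "C > 0" and LSI: "satisfies_LSI C \<mu>"
    and f: "\<And>x. \<bar>f x\<bar> \<le> M" and r: "1 \<le> r" "r < s" and small: "(3 * M / C) * (s - r) \<le> 1"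
  shows "C * r * ln (\<integral>x. exp (inf_conv r f x / (C * r)) \<partial>\<mu>)
    \<le> C * s * ln (\<integral>x. exp (inf_conv s f x / (C * s)) \<partial>\<mu>) + C * r * ((3 * M / C) * (s - r))\<^sup>2"
proof -
  interpret prob_space \<mu> by fact
  define h where "h = s - r"
  define \<theta> where "\<theta> = 1 / (C * s)"
  define \<kappa> where "\<kappa> = 1 / (C * r)"
  define g where "g = inf_conv s f"
  define u where "u x = (inf_conv s f x - inf_conv r f x) / (s - r)" for x
  define w where "w x = \<kappa> * inf_conv r f x - \<theta> * g x" for x
  \<comment> \<open>A uniform bound on \<open>w\<close>: the part with \<open>g\<close> contributes
    at most \<open>M / C * h\<close> and the part with \<open>u\<close> at most
    \<open>2 * M / C * h\<close>, using \<open>r \<ge> 1\<close>.\<close>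
  define \<delta> where "\<delta> = (3 * M / C) * h"
  have pos: "s > 0" "r > 0" "h > 0" "\<theta> > 0" "\<kappa> > 0" using r \<open>C > 0\<close> by (auto simp: h_def \<theta>_def \<kappa>_def)
  have g: "\<bar>g x\<bar> \<le> M" for x using inf_conv_bounded[of f M s x] f pos by (simp add: g_def)
  have M: "M \<ge> 0" using f[of undefined] by linarith
  have [measurable]: "g \<in> borel_measurable borel" "u \<in> borel_measurable borel" "inf_conv r f \<in> borel_measurable borel"
    using inf_conv_measurable[of f M, OF f pos(1)] inf_conv_measurable[of f M, OF f pos(2)]
    unfolding g_def u_def by simp_all
  have u0: "0 \<le> u x" for x
    using inf_conv_mono[of f M r s x] f pos r by (simp add: u_def)
  have u: "\<bar>u x\<bar> \<le> 2 * M" for x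
  proof -
    have "u x \<le> 2 * M / r"
      using inf_conv_increment_le[of f M r s x] f r by (simp add: u_def divide_le_eq mult.commute)
    also have "\<dots> \<le> 2 * M" using r M by (simp add: divide_le_eq mult_le_cancel_left1)
    finally show ?thesis using u0[of x] by simp
  qed
  \<comment> \<open>The third identity is the reason for \<open>\<theta> = 1 / (C * s)\<close>: the
    constant produced by LSI becomes the coefficient \<open>\<theta> * s\<close> that
    \<open>u\<close> has in \<open>w\<close>.\<close>
  have \<kappa>: "\<kappa> = \<theta> * s / r" "\<kappa> - \<theta> = \<theta> * h / r" "C * \<theta>\<^sup>2 * s\<^sup>2 = \<theta> * s"
    using \<open>C > 0\<close> pos by (auto simp: \<theta>_def \<kappa>_def h_def field_simps power2_eq_square)
  \<comment> \<open>An exact splitting: the term with \<open>g\<close> comes from changing the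
    exponent \<open>\<theta>\<close> to \<open>\<kappa>\<close>, the term with \<open>u\<close> from
    changing the infimal convolution. Weighted by \<open>exp (\<theta> * g x)\<close> and
    integrated, they become the energy term of the entropy and the right-hand side of LSI.\<close>
  have w_eq: "w x = (h / r) * (\<theta> * g x) - (h / r) * (\<theta> * s) * u x" for x
  proof -
    have *: "inf_conv r f x = g x - h * u x" using pos by (simp add: g_def u_def h_def)
    have "w x = (\<kappa> - \<theta>) * g x - \<kappa> * h * u x" unfolding w_def * by (simp add: algebra_simps)
    then show ?thesis unfolding \<kappa>(2) unfolding \<kappa>(1) by (simp add: mult_ac)
  qed
  have w: "\<bar>w x\<bar> \<le> \<delta>" for x
  proof -
    have "\<theta> \<le> 1 / C" "\<theta> * s = 1 / C" "h / r \<le> h" using \<open>C > 0\<close> r pos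
      by (auto simp: \<theta>_def field_simps mult_le_cancel_left1)
    moreover from this have "\<bar>\<theta> * g x\<bar> \<le> 1 / C * M" "\<bar>(\<theta> * s) * u x\<bar> \<le> 1 / C * (2 * M)"
      unfolding abs_mult using pos \<open>C > 0\<close> g[of x] u[of x] M by (intro mult_mono; simp)+
    ultimately have "\<bar>(h / r) * (\<theta> * g x)\<bar> \<le> h * (1 / C * M)" "\<bar>(h / r) * ((\<theta> * s) * u x)\<bar> \<le> h * (1 / C * (2 * M))"
      unfolding abs_mult[of "h / r"] using pos by (intro mult_mono; simp)+
    moreover have "h * (1 / C * M) + h * (1 / C * (2 * M)) = \<delta>" by (simp add: \<delta>_def)
    ultimately show ?thesis unfolding w_eq mult.assoc[of "h / r"]
      by (intro order_trans[OF abs_triangle_ineq4]) linarith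
  qed
  have w1: "\<bar>w x\<bar> \<le> 1" for x using w[of x] small by (simp add: \<delta>_def h_def)
  have w2: "(w x)\<^sup>2 \<le> \<delta>\<^sup>2" for x using w[of x] by (metis abs_le_square_iff abs_of_nonneg abs_ge_zero order_trans)
  have e: "exp (\<theta> * g x) \<le> exp (\<theta> * M)" for x
    using g[of x] pos by simp
  have int: "integrable \<mu> (\<lambda>x. k x * exp (\<theta> * g x))"
    if [measurable]: "k \<in> borel_measurable borel" and "\<And>x. \<bar>k x\<bar> \<le> b" for k b
  proof (rule integrable_bounded_borel[OF \<mu>])
    show "\<bar>k x * exp (\<theta> * g x)\<bar> \<le> b * exp (\<theta> * M)" for x
      unfolding abs_mult using that(2)[of x] e[of x] by (intro mult_mono) auto
  qed measurable
  have int_pos: "0 < (\<integral>x. exp (k x) \<partial>\<mu>)" if "integrable \<mu> (\<lambda>x. exp (k x))" for k :: "'a \<Rightarrow> real"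
    using integral_less_AE_space[of "\<lambda>_. 0" "\<lambda>x. exp (k x)"] that by (simp add: emeasure_space_1)
  define Z where "Z = (\<integral>x. exp (\<theta> * g x) \<partial>\<mu>)"
  define A where "A = (\<integral>x. g x * exp (\<theta> * g x) \<partial>\<mu>)"
  define U where "U = (\<integral>x. u x * exp (\<theta> * g x) \<partial>\<mu>)"
  have iZ: "integrable \<mu> (\<lambda>x. exp (\<theta> * g x))" using int[of "\<lambda>_. 1" 1] by simp
  note iA = int[of g, OF _ g, simplified] and iU = int[of u, OF _ u, simplified]
  have "Z > 0" unfolding Z_def using iZ by (rule int_pos)
  have "\<theta> * A - Z * ln Z \<le> \<theta> * s * U"
    using Ent_exp_inf_conv_le[of \<mu> C f M r s \<theta>] \<mu> \<open>C > 0\<close> LSI f pos r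
    unfolding \<kappa>(3) by (simp add: A_def U_def Z_def g_def u_def)
  then have LSI': "(h / r) * (\<theta> * A - Z * ln Z) \<le> (h / r) * (\<theta> * s * U)"
    using pos by (intro mult_left_mono) auto
  have eq: "exp (\<kappa> * inf_conv r f x) = exp (w x) * exp (\<theta> * g x)" for x
    by (simp add: w_def exp_add[symmetric])
  have iK: "integrable \<mu> (\<lambda>x. exp (\<kappa> * inf_conv r f x))"
    unfolding eq
  proof (rule int)
    show "\<bar>exp (w x)\<bar> \<le> exp 1" for x using w1[of x] by simp
  qed (simp add: w_def)
  have "(\<integral>x. exp (\<kappa> * inf_conv r f x) \<partial>\<mu>)
      \<le> (\<integral>x. (1 + \<delta>\<^sup>2) * exp (\<theta> * g x) + ((h / r) * \<theta> * (g x * exp (\<theta> * g x)) - (h / r) * (\<theta> * s) * (u x * exp (\<theta> * g x))) \<partial>\<mu>)"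
  proof (rule integral_mono[OF iK])
    show "integrable \<mu> (\<lambda>x. (1 + \<delta>\<^sup>2) * exp (\<theta> * g x) + ((h / r) * \<theta> * (g x * exp (\<theta> * g x)) - (h / r) * (\<theta> * s) * (u x * exp (\<theta> * g x))))"
      by (intro Bochner_Integration.integrable_add Bochner_Integration.integrable_diff integrable_mult_right iZ iA iU)
    fix x
    have "exp (w x) \<le> 1 + \<delta>\<^sup>2 + w x" using exp_le_one_plus_square[OF w1[of x]] w2[of x] by simp
    then have "exp (w x) * exp (\<theta> * g x) \<le> (1 + \<delta>\<^sup>2 + w x) * exp (\<theta> * g x)"
      by (rule mult_right_mono) simp
    then show "exp (\<kappa> * inf_conv r f x) \<le> (1 + \<delta>\<^sup>2) * exp (\<theta> * g x) + ((h / r) * \<theta> * (g x * exp (\<theta> * g x)) - (h / r) * (\<theta> * s) * (u x * exp (\<theta> * g x)))"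
      unfolding eq w_eq by (simp add: algebra_simps)
  qed
  also have "\<dots> = (1 + \<delta>\<^sup>2) * Z + ((h / r) * \<theta> * A - (h / r) * (\<theta> * s) * U)"
    unfolding Z_def A_def U_def
    by (subst Bochner_Integration.integral_add Bochner_Integration.integral_diff integral_mult_right_zero;
        (intro Bochner_Integration.integrable_add Bochner_Integration.integrable_diff integrable_mult_right iZ iA iU)?)+ simp
  \<comment> \<open>LSI cancels both first-order integrals and leaves only
    \<open>(h / r) * Z * ln Z\<close>.\<close>
  also have "\<dots> \<le> Z * (1 + ((h / r) * ln Z + \<delta>\<^sup>2))"
    using LSI' by (simp add: algebra_simps)
  finally have *: "(\<integral>x. exp (\<kappa> * inf_conv r f x) \<partial>\<mu>) \<le> Z * (1 + ((h / r) * ln Z + \<delta>\<^sup>2))" .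
  also have "\<dots> \<le> Z * exp ((h / r) * ln Z + \<delta>\<^sup>2)"
    using \<open>Z > 0\<close> exp_ge_add_one_self[of "(h / r) * ln Z + \<delta>\<^sup>2"] by (intro mult_left_mono) auto
  finally have "ln (\<integral>x. exp (\<kappa> * inf_conv r f x) \<partial>\<mu>) \<le> ln (Z * exp ((h / r) * ln Z + \<delta>\<^sup>2))"
    using int_pos[OF iK] \<open>Z > 0\<close> by (subst ln_le_cancel_iff) auto
  \<comment> \<open>Since \<open>1 + h / r = s / r\<close>, the leftover logarithm changes the
    prefactor \<open>C * r\<close> into \<open>C * s\<close>.\<close>
  also have "\<dots> = (s / r) * ln Z + \<delta>\<^sup>2"
    using \<open>Z > 0\<close> pos by (simp add: ln_mult h_def field_simps)
  finally have "C * r * ln (\<integral>x. exp (\<kappa> * inf_conv r f x) \<partial>\<mu>) \<le> C * r * ((s / r) * ln Z + \<delta>\<^sup>2)"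
    using \<open>C > 0\<close> pos by (intro mult_left_mono) auto
  also have "\<dots> = C * s * ln Z + C * r * \<delta>\<^sup>2" using pos by (simp add: field_simps)
  finally show ?thesis by (simp add: Z_def \<theta>_def \<kappa>_def g_def \<delta>_def h_def)
qed

text \<open>In \<open>N\<close> equal steps from 1 to \<open>S\<close> each error is quadratic in
  the step length, so the total is of order \<open>1 / N\<close> and disappears in the limit. The
  lower bound on \<open>N\<close> in \<open>steps\<close> is the smallness condition of a single
  step.\<close>

lemma log_exp_moment_mono:
  fixes f :: "'a::metric_space \<Rightarrow> real"
  assumes \<mu>: "prob_space \<mu>" "sets \<mu> = sets borel" and "C > 0" and LSI: "satisfies_LSI C \<mu>"
    and f: "\<And>x. \<bar>f x\<bar> \<le> M" and S: "1 < S"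
  shows "C * ln (\<integral>x. exp (inf_conv 1 f x / C) \<partial>\<mu>) \<le> C * S * ln (\<integral>x. exp (inf_conv S f x / (C * S)) \<partial>\<mu>)"
proof -
  define \<Phi> where "\<Phi> s = C * s * ln (\<integral>x. exp (inf_conv s f x / (C * s)) \<partial>\<mu>)" for s
  define K where "K = 3 * M / C"
  have "M \<ge> 0" using f[of undefined] by linarith
  then have "K \<ge> 0" using \<open>C > 0\<close> by (simp add: K_def)
  have steps: "\<Phi> 1 \<le> \<Phi> S + C * S * (K * (S - 1))\<^sup>2 / N"
    if N: "N > 0" "K * (S - 1) \<le> real N" for N :: nat
  proof -
    define h where "h = (S - 1) / N"
    have h: "h > 0" "K * h \<le> 1" "N * h = S - 1" using N S by (auto simp: h_def field_simps)
    have "\<Phi> 1 \<le> \<Phi> (1 + i * h) + i * (C * S * (K * h)\<^sup>2)" if "i \<le> N" for i :: nat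
      using that
    proof (induction i)
      case (Suc i)
      have "i * h \<le> N * h" using Suc.prems h by (intro mult_right_mono) auto
      then have le: "1 + i * h \<le> S" using h by simp
      have "\<Phi> (1 + i * h) \<le> \<Phi> (1 + i * h + h) + C * (1 + i * h) * (K * h)\<^sup>2"
        using log_exp_moment_step[of \<mu> C f M "1 + i * h" "1 + i * h + h"] assms h
        unfolding \<Phi>_def K_def by simp
      also have "C * (1 + i * h) * (K * h)\<^sup>2 \<le> C * S * (K * h)\<^sup>2"
        using le \<open>C > 0\<close> by (intro mult_right_mono mult_left_mono) auto
      finally show ?case using Suc by (simp add: algebra_simps)
    qed simp
    from this[of N] have "\<Phi> 1 \<le> \<Phi> S + N * (C * S * (K * h)\<^sup>2)" using h(3) by simp
    also have "N * (C * S * (K * h)\<^sup>2) = C * S * (K * (S - 1))\<^sup>2 / N"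
      using N by (simp add: h_def power2_eq_square)
    finally show ?thesis .
  qed
  have "(\<lambda>N. \<Phi> S + C * S * (K * (S - 1))\<^sup>2 / real N) \<longlonglongrightarrow> \<Phi> S + 0"
    by (intro tendsto_intros real_tendsto_divide_at_top filterlim_real_sequentially)
  moreover have "\<forall>\<^sub>F N in sequentially. \<Phi> 1 \<le> \<Phi> S + C * S * (K * (S - 1))\<^sup>2 / real N"
    using eventually_gt_at_top[of 0] eventually_ge_at_top[of "nat \<lceil>K * (S - 1)\<rceil>"]
    by eventually_elim (rule steps, auto simp: le_nat_iff ceiling_le_iff nat_le_iff)
  ultimately have "\<Phi> 1 \<le> \<Phi> S + 0"
    by (intro tendsto_lowerbound) auto
  then show ?thesis by (simp add: \<Phi>_def)
qed

text \<open>For large \<open>S\<close> the exponent \<open>t = 1 / (C * S)\<close> is small. With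
  \<open>inf_conv S f \<le> f\<close>, a second-order bound of the exponential makes the right-hand
  side of the monotonicity estimate at most the integral of \<open>f\<close> plus
  \<open>M\<^sup>2 / (C * S)\<close>.\<close>

lemma LSI_imp_exp_inf_conv_le:
  fixes f :: "'a::metric_space \<Rightarrow> real"
  assumes \<mu>: "prob_space \<mu>" "sets \<mu> = sets borel" and "C > 0" and LSI: "satisfies_LSI C \<mu>"
    and f: "\<And>x. \<bar>f x\<bar> \<le> M" and [measurable]: "f \<in> borel_measurable borel"
  shows "C * ln (\<integral>x. exp (inf_conv 1 f x / C) \<partial>\<mu>) \<le> (\<integral>x. f x \<partial>\<mu>)"
proof -
  interpret prob_space \<mu> by fact
  have if': "integrable \<mu> f" using \<mu> by (rule integrable_bounded_borel) (use f in auto)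
  have *: "C * ln (\<integral>x. exp (inf_conv 1 f x / C) \<partial>\<mu>) \<le> (\<integral>x. f x \<partial>\<mu>) + M\<^sup>2 / (C * S)"
    if S: "S > 1" "C * S \<ge> M" for S
  proof -
    define t where "t = 1 / (C * S)"
    have t: "t > 0" "C * S * t = 1" using S \<open>C > 0\<close> by (auto simp: t_def)
    have ft: "\<bar>t * f x\<bar> \<le> t * M" for x using f[of x] t by (simp add: abs_mult)
    have "t * M \<le> 1" using S \<open>C > 0\<close> by (simp add: t_def)
    have [measurable]: "inf_conv S f \<in> borel_measurable borel"
      using inf_conv_measurable[of f M S, OF f] S by simp
    have ie: "integrable \<mu> (\<lambda>x. exp (t * k x))" if "k \<in> borel_measurable borel" "\<And>x. \<bar>k x\<bar> \<le> M" for k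
      using \<mu>
    proof (rule integrable_bounded_borel)
      show "\<bar>exp (t * k x)\<bar> \<le> exp (t * M)" for x using that(2)[of x] t by (simp add: mult_left_mono)
    qed (use that in simp)
    have i1: "integrable \<mu> (\<lambda>x. exp (t * inf_conv S f x))"
      using inf_conv_bounded[of f M S] f S by (intro ie) auto
    have "(\<integral>x. exp (t * inf_conv S f x) \<partial>\<mu>) \<le> (\<integral>x. (1 + (t * M)\<^sup>2) + t * f x \<partial>\<mu>)"
    proof (rule integral_mono[OF i1])
      show "integrable \<mu> (\<lambda>x. (1 + (t * M)\<^sup>2) + t * f x)" using if' by simp
      fix x
      have "exp (t * inf_conv S f x) \<le> exp (t * f x)"
        using inf_conv_le_self[of f M S x] f S t by (simp add: mult_left_mono)
      also have "\<dots> \<le> 1 + t * f x + (t * f x)\<^sup>2"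
        using ft[of x] \<open>t * M \<le> 1\<close> by (intro exp_le_one_plus_square) simp
      also have "(t * f x)\<^sup>2 \<le> (t * M)\<^sup>2"
        using ft[of x] abs_le_square_iff[of "t * f x" "t * M"] by simp
      finally show "exp (t * inf_conv S f x) \<le> (1 + (t * M)\<^sup>2) + t * f x" by simp
    qed
    also have "\<dots> = 1 + (t * (\<integral>x. f x \<partial>\<mu>) + (t * M)\<^sup>2)" using if' by (simp add: prob_space)
    also have "\<dots> \<le> exp (t * (\<integral>x. f x \<partial>\<mu>) + (t * M)\<^sup>2)" by (rule exp_ge_add_one_self)
    finally have "ln (\<integral>x. exp (t * inf_conv S f x) \<partial>\<mu>) \<le> ln (exp (t * (\<integral>x. f x \<partial>\<mu>) + (t * M)\<^sup>2))"
      using integral_less_AE_space[of "\<lambda>_. 0" "\<lambda>x. exp (t * inf_conv S f x)"] i1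
      by (subst ln_le_cancel_iff) (auto simp: emeasure_space_1)
    then have "C * S * ln (\<integral>x. exp (t * inf_conv S f x) \<partial>\<mu>) \<le> C * S * (t * (\<integral>x. f x \<partial>\<mu>) + (t * M)\<^sup>2)"
      using S \<open>C > 0\<close> by (intro mult_left_mono) auto
    also have "\<dots> = (C * S * t) * (\<integral>x. f x \<partial>\<mu>) + (C * S * t) * t * M\<^sup>2"
      by (simp add: algebra_simps power2_eq_square)
    also have "\<dots> = (\<integral>x. f x \<partial>\<mu>) + M\<^sup>2 / (C * S)" unfolding t(2) by (simp add: t_def)
    finally show ?thesis
      using log_exp_moment_mono[of \<mu> C f M S, OF \<mu> \<open>C > 0\<close> LSI f S(1)]
      unfolding t_def by (simp del: mult_le_cancel_left_pos add: mult.assoc)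
  qed
  have "filterlim (\<lambda>S. C * S) at_top at_top"
    using \<open>C > 0\<close> by (intro filterlim_tendsto_pos_mult_at_top[OF tendsto_const] filterlim_ident)
  then have "((\<lambda>S. (\<integral>x. f x \<partial>\<mu>) + M\<^sup>2 / (C * S)) \<longlongrightarrow> (\<integral>x. f x \<partial>\<mu>) + 0) at_top"
    by (intro tendsto_add tendsto_const real_tendsto_divide_at_top[OF tendsto_const])
  moreover have "\<forall>\<^sub>F S in at_top. C * ln (\<integral>x. exp (inf_conv 1 f x / C) \<partial>\<mu>) \<le> (\<integral>x. f x \<partial>\<mu>) + M\<^sup>2 / (C * S)"
    using eventually_gt_at_top[of 1] eventually_ge_at_top[of "M / C"]
    by eventually_elim (rule *, use \<open>C > 0\<close> in \<open>auto simp: field_simps\<close>)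
  ultimately have "C * ln (\<integral>x. exp (inf_conv 1 f x / C) \<partial>\<mu>) \<le> (\<integral>x. f x \<partial>\<mu>) + 0"
    by (rule tendsto_lowerbound) simp
  then show ?thesis by simp
qed

section \<open>The entropy inequality\<close>

lemma rel_entropy_finite_density:
  assumes \<mu>: "prob_space \<mu>" and \<nu>: "prob_space \<nu>" and fin: "rel_entropy \<nu> \<mu> \<noteq> \<infinity>"
  obtains r where "r \<in> borel_measurable \<mu>" "\<And>x. 0 \<le> r x" "\<nu> = density \<mu> (\<lambda>x. ennreal (r x))"
    "integrable \<nu> (\<lambda>x. ln (r x))" "rel_entropy \<nu> \<mu> = ereal (\<integral>x. ln (r x) \<partial>\<nu>)"
proof -
  interpret M: prob_space \<mu> by fact
  interpret N: prob_space \<nu> by fact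
  have ac: "sets \<nu> = sets \<mu>" "absolutely_continuous \<mu> \<nu>"
    and int: "integrable \<nu> (\<lambda>x. ln (enn2real (RN_deriv \<mu> \<nu> x)))"
    using fin unfolding rel_entropy_def by (auto split: if_splits)
  have "AE x in \<mu>. RN_deriv \<mu> \<nu> x \<noteq> \<infinity>"
    using ac N.sigma_finite_measure_axioms by (intro M.RN_deriv_finite) auto
  then have "density \<mu> (\<lambda>x. ennreal (enn2real (RN_deriv \<mu> \<nu> x))) = density \<mu> (RN_deriv \<mu> \<nu>)"
    by (intro density_cong) (auto simp: less_top)
  also have "\<dots> = \<nu>" using ac by (intro M.density_RN_deriv) auto
  finally show ?thesis
    using that[of "\<lambda>x. enn2real (RN_deriv \<mu> \<nu> x)"] ac int by (simp add: rel_entropy_def)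
qed

text \<open>The Gibbs variational inequality: \<open>ln q \<le> q - 1\<close> is integrated against
  \<nu>, where \<open>q\<close> is the density, relative to \<nu>, of the tilted probability measure
  with \<mu>-density \<open>exp (\<phi> x) / Z\<close>.\<close>

lemma integral_le_rel_entropy:
  assumes \<mu>: "prob_space \<mu>" and \<nu>: "prob_space \<nu>" and sets: "sets \<nu> = sets \<mu>"
    and H: "rel_entropy \<nu> \<mu> = ereal H"
    and [measurable]: "\<phi> \<in> borel_measurable \<mu>" and b: "\<And>x. \<bar>\<phi> x\<bar> \<le> b"
  shows "(\<integral>x. \<phi> x \<partial>\<nu>) \<le> H + ln (\<integral>x. exp (\<phi> x) \<partial>\<mu>)"
proof -
  interpret M: prob_space \<mu> by fact
  interpret N: prob_space \<nu> by fact
  obtain r where r[measurable]: "r \<in> borel_measurable \<mu>" and r0: "\<And>x. 0 \<le> r x"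
    and \<nu>_eq: "\<nu> = density \<mu> (\<lambda>x. ennreal (r x))"
    and int: "integrable \<nu> (\<lambda>x. ln (r x))" and "rel_entropy \<nu> \<mu> = ereal (\<integral>x. ln (r x) \<partial>\<nu>)"
    using rel_entropy_finite_density[OF \<mu> \<nu>] H by (metis PInfty_neq_ereal(1))
  then have H_eq: "H = (\<integral>x. ln (r x) \<partial>\<nu>)" using H by simp
  define Z where "Z = (\<integral>x. exp (\<phi> x) \<partial>\<mu>)"
  have iM: "integrable \<mu> (\<lambda>x. exp (\<phi> x))"
    by (rule M.integrable_const_bound[where B = "exp b"]) (use b in \<open>auto simp: abs_le_iff\<close>)
  have \<phi>N: "\<phi> \<in> borel_measurable \<nu>" by (subst measurable_cong_sets[OF sets refl]) measurable
  have iN: "integrable \<nu> \<phi>"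
    by (rule N.integrable_const_bound[where B = b]) (use b \<phi>N in auto)
  have "Z > 0"
    unfolding Z_def using M.integral_less_AE_space[of "\<lambda>_. 0" "\<lambda>x. exp (\<phi> x)"] iM
    by (simp add: M.emeasure_space_1)
  have AE_pos: "AE x in \<nu>. r x > 0"
    unfolding \<nu>_eq by (subst AE_density) (auto simp: ennreal_zero_less_mult_iff)
  \<comment> \<open>The tilted measure can charge the set where \<open>r\<close> vanishes, which
    \<nu> does not see. Hence \<open>q\<close> has \<nu>-integral at most 1 rather than equal to 1,
    which is the direction required.\<close>
  define q where "q x = (if r x > 0 then exp (\<phi> x) / (r x * Z) else 0)" for x
  have [measurable]: "q \<in> borel_measurable \<mu>" unfolding q_def by measurable
  have rq: "r x * q x = (if r x > 0 then exp (\<phi> x) / Z else 0)" for x by (simp add: q_def)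
  have iq': "integrable \<mu> (\<lambda>x. r x * q x)"
    by (rule Bochner_Integration.integrable_bound[where f = "\<lambda>x. exp (\<phi> x) / Z"])
       (use iM \<open>Z > 0\<close> in \<open>auto simp: rq\<close>)
  then have iq: "integrable \<nu> q"
    unfolding \<nu>_eq by (subst integrable_density) (auto simp: r0)
  have "(\<integral>x. q x \<partial>\<nu>) = (\<integral>x. r x * q x \<partial>\<mu>)"
    unfolding \<nu>_eq by (subst integral_density) (auto simp: r0)
  also have "\<dots> \<le> (\<integral>x. exp (\<phi> x) / Z \<partial>\<mu>)"
    using iq' iM \<open>Z > 0\<close> by (intro integral_mono) (auto simp: rq)
  also have "\<dots> = 1" using \<open>Z > 0\<close> by (simp add: Z_def)
  finally have q1: "(\<integral>x. q x \<partial>\<nu>) \<le> 1" .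
  have "(\<integral>x. \<phi> x - ln (r x) - ln Z \<partial>\<nu>) \<le> (\<integral>x. q x - 1 \<partial>\<nu>)"
  proof (rule integral_mono_AE)
    show "AE x in \<nu>. \<phi> x - ln (r x) - ln Z \<le> q x - 1"
      using AE_pos
    proof eventually_elim
      case (elim x)
      have "ln (q x) \<le> q x - 1" using elim \<open>Z > 0\<close> by (intro ln_le_minus_one) (simp add: q_def)
      then show ?case using elim \<open>Z > 0\<close> by (simp add: q_def ln_div ln_mult)
    qed
  qed (use iN int iq in auto)
  then have "(\<integral>x. \<phi> x \<partial>\<nu>) - H - ln Z \<le> (\<integral>x. q x \<partial>\<nu>) - 1"
    using iN int iq by (simp add: H_eq N.prob_space)
  then show ?thesis using q1 by (simp add: Z_def)
qed

section \<open>Approximate Kantorovich duality\<close>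

text \<open>Induction on the set of constraints (Bartl): if dropping a constraint makes the implication
  fail at x, then projecting along x onto the kernel of that constraint eliminates it.\<close>
lemma farkas_lemma:
  fixes A :: "'j \<Rightarrow> 'i \<Rightarrow> real" and c :: "'i \<Rightarrow> real"
  assumes "finite I" "finite J"
    and "\<And>x. (\<And>j. j \<in> J \<Longrightarrow> (\<Sum>i\<in>I. A j i * x i) \<le> 0) \<Longrightarrow> (\<Sum>i\<in>I. c i * x i) \<le> 0"
  obtains u where "\<And>j. j \<in> J \<Longrightarrow> 0 \<le> u j" "\<And>i. i \<in> I \<Longrightarrow> c i = (\<Sum>j\<in>J. u j * A j i)"
proof -
  have "\<exists>u. (\<forall>j\<in>J. 0 \<le> u j) \<and> (\<forall>i\<in>I. c i = (\<Sum>j\<in>J. u j * A j i))"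
    using assms(2,3)
  proof (induction J arbitrary: A c rule: finite_induct)
    case empty
    \<comment> \<open>With no constraints, \<open>c\<close> itself is a test vector.\<close>
    have "(\<Sum>i\<in>I. c i * c i) \<le> 0" using empty by simp
    then have "\<forall>i\<in>I. c i = 0" using assms(1)
      by (smt (verit) sum_nonneg_eq_0_iff sum_nonneg zero_le_square mult_eq_0_iff)
    then show ?case by simp
  next
    case (insert k J)
    let ?d = "\<lambda>a x. \<Sum>i\<in>I. a i * x i"
    show ?case
    proof (cases "\<forall>x. (\<forall>j\<in>J. ?d (A j) x \<le> 0) \<longrightarrow> ?d c x \<le> 0")
      case True
      with insert.IH[of A c] obtain u where u: "\<forall>j\<in>J. 0 \<le> u j" "\<forall>i\<in>I. c i = (\<Sum>j\<in>J. u j * A j i)"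
        by blast
      show ?thesis
        using u insert.hyps by (intro exI[of _ "u(k := 0)"]) (auto intro!: sum.cong)
    next
      case False
      then obtain x' where x': "\<forall>j\<in>J. ?d (A j) x' \<le> 0" "?d c x' > 0" by (auto simp: not_le)
      \<comment> \<open>Otherwise \<open>x'\<close> would satisfy every constraint while having a
        positive \<open>c\<close>-value.\<close>
      have k: "?d (A k) x' > 0" using insert.prems[of x'] x' by force
      define x where "x i = x' i / ?d (A k) x'" for i
      have dx: "?d a x = ?d a x' / ?d (A k) x'" for a
        by (simp add: x_def sum_divide_distrib)
      have x: "?d (A j) x \<le> 0" if "j \<in> J" for j
        unfolding dx using x'(1) k that by (auto intro: divide_nonpos_pos)
      have cx: "?d c x > 0" and kx: "?d (A k) x = 1" unfolding dx using x'(2) k by auto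
      \<comment> \<open>\<open>B j\<close> and \<open>b\<close> are \<open>A j\<close> and
        \<open>c\<close> composed with the projection of \<open>y\<close> to
        \<open>y - (A k y) x\<close>, which lands in the kernel of \<open>A k\<close>. Constraint
        \<open>k\<close> then holds with equality, so the induction hypothesis applies to
        \<open>B\<close> and \<open>b\<close>.\<close>
      define B where "B j i = A j i - ?d (A j) x * A k i" for j i
      define b where "b i = c i - ?d c x * A k i" for i
      have proj: "?d (\<lambda>i. a i - t * A k i) y = ?d a y - t * ?d (A k) y" for a t y
        by (simp add: sum_subtractf sum_distrib_left algebra_simps)
      have proj': "?d a (\<lambda>i. y i - t * x i) = ?d a y - t * ?d a x" for a t y
        by (simp add: sum_subtractf sum_distrib_left algebra_simps)
      have "?d b y \<le> 0" if y: "\<And>j. j \<in> J \<Longrightarrow> ?d (B j) y \<le> 0" for y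
      proof -
        have "?d c (\<lambda>i. y i - ?d (A k) y * x i) \<le> 0"
        proof (rule insert.prems)
          fix j assume "j \<in> insert k J"
          moreover have "?d (A k) (\<lambda>i. y i - ?d (A k) y * x i) \<le> 0" unfolding proj' kx by simp
          moreover have "?d (A j) (\<lambda>i. y i - ?d (A k) y * x i) \<le> 0" if "j \<in> J"
            using y[OF that] unfolding proj' B_def proj by (simp add: mult.commute)
          ultimately show "?d (A j) (\<lambda>i. y i - ?d (A k) y * x i) \<le> 0" by blast
        qed
        then show ?thesis unfolding proj' b_def proj by (simp add: mult.commute)
      qed
      then obtain u where u: "\<forall>j\<in>J. 0 \<le> u j" "\<forall>i\<in>I. b i = (\<Sum>j\<in>J. u j * B j i)"
        using insert.IH[of B b] by blast
      \<comment> \<open>Expanding \<open>B\<close> and \<open>b\<close> collects all multiples of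
        \<open>A k\<close> into this coefficient. It is nonnegative because \<open>c\<close> is
        positive at \<open>x\<close> and every \<open>A j\<close> with \<open>j \<in> J\<close> is
        nonpositive there.\<close>
      define v where "v = u(k := ?d c x - (\<Sum>j\<in>J. u j * ?d (A j) x))"
      have "(\<Sum>j\<in>J. u j * ?d (A j) x) \<le> 0"
        by (rule sum_nonpos, rule mult_nonneg_nonpos[OF _ x]) (use u(1) in auto)
      then have "\<forall>j\<in>insert k J. 0 \<le> v j" using u(1) cx by (auto simp: v_def)
      moreover have "c i = (\<Sum>j\<in>insert k J. v j * A j i)" if "i \<in> I" for i
      proof -
        have "c i - ?d c x * A k i = (\<Sum>j\<in>J. u j * B j i)" using u(2) that by (simp add: b_def)
        also have "\<dots> = (\<Sum>j\<in>J. u j * A j i) - (\<Sum>j\<in>J. u j * ?d (A j) x) * A k i"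
          by (simp add: B_def right_diff_distrib sum_subtractf sum_distrib_right mult.assoc)
        finally have "c i = (\<Sum>j\<in>J. u j * A j i) + (?d c x - (\<Sum>j\<in>J. u j * ?d (A j) x)) * A k i"
          by (simp add: algebra_simps)
        also have "(\<Sum>j\<in>J. u j * A j i) = (\<Sum>j\<in>J. v j * A j i)"
          using insert.hyps by (auto simp: v_def intro!: sum.cong)
        finally show ?thesis using insert.hyps by (simp add: v_def)
      qed
      ultimately show ?thesis by blast
    qed
  qed
  then show ?thesis using that by blast
qed

text \<open>The index None stands for a scaling variable that homogenizes the dual problem, and for the constraint
  that it is nonnegative.\<close>
lemma finite_transport_duality:
  fixes c :: "'a \<Rightarrow> 'b \<Rightarrow> real"
  assumes fin: "finite I" "finite J"
    and p: "\<And>i. i \<in> I \<Longrightarrow> 0 \<le> p i" "sum p I = 1" and q: "\<And>j. j \<in> J \<Longrightarrow> 0 \<le> q j" "sum q J = 1"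
    and dual: "\<And>\<alpha> \<beta>. (\<And>i j. i \<in> I \<Longrightarrow> j \<in> J \<Longrightarrow> \<alpha> i - \<beta> j \<le> c i j)
        \<Longrightarrow> (\<Sum>i\<in>I. \<alpha> i * p i) - (\<Sum>j\<in>J. \<beta> j * q j) \<le> V"
  obtains \<pi> where "\<And>i j. i \<in> I \<Longrightarrow> j \<in> J \<Longrightarrow> 0 \<le> \<pi> i j"
    "\<And>i. i \<in> I \<Longrightarrow> (\<Sum>j\<in>J. \<pi> i j) = p i" "\<And>j. j \<in> J \<Longrightarrow> (\<Sum>i\<in>I. \<pi> i j) = q j"
    "(\<Sum>i\<in>I. \<Sum>j\<in>J. \<pi> i j * c i j) \<le> V"
proof -
  define L where "L = insert None (Some ` (I <+> J))"
  define R where "R = insert None (Some ` (I \<times> J))"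
  \<comment> \<open>Columns carry the scale \<tau> (\<open>None\<close>), the potential \<alpha>
    (\<open>Inl\<close>) and the potential \<beta> (\<open>Inr\<close>). Row
    \<open>Some (i, j)\<close> says \<open>\<alpha> i - \<beta> j \<le> \<tau> * c i j\<close>; row
    \<open>None\<close> says \<open>\<tau> \<ge> 0\<close>. The multipliers of the rows
    \<open>Some (i, j)\<close> form the transport plan.\<close>
  define A :: "('a \<times> 'b) option \<Rightarrow> ('a + 'b) option \<Rightarrow> real" where
    "A k l = (case k of None \<Rightarrow> (case l of None \<Rightarrow> - 1 | Some _ \<Rightarrow> 0)
      | Some (i, j) \<Rightarrow> (case l of None \<Rightarrow> - c i j
          | Some (Inl i') \<Rightarrow> if i' = i then 1 else 0 | Some (Inr j') \<Rightarrow> if j' = j then - 1 else 0))" for k l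
  define C where "C l = (case l of None \<Rightarrow> - V | Some (Inl i) \<Rightarrow> p i | Some (Inr j) \<Rightarrow> - q j)" for l
  have sum_L: "sum g L = g None + (\<Sum>i\<in>I. g (Some (Inl i))) + (\<Sum>j\<in>J. g (Some (Inr j)))"
    for g :: "('a + 'b) option \<Rightarrow> real"
    using fin by (simp add: L_def sum.reindex sum.Plus)
  have L_in: "i \<in> I \<Longrightarrow> Some (Inl i) \<in> L" "j \<in> J \<Longrightarrow> Some (Inr j) \<in> L" for i j
    by (auto simp: L_def)
  have sum_R: "sum g R = g None + (\<Sum>i\<in>I. \<Sum>j\<in>J. g (Some (i, j)))" for g :: "('a \<times> 'b) option \<Rightarrow> real"
    using fin by (simp add: R_def sum.reindex sum.cartesian_product case_prod_unfold)
  obtain u where u: "\<And>k. k \<in> R \<Longrightarrow> 0 \<le> u k" "\<And>l. l \<in> L \<Longrightarrow> C l = (\<Sum>k\<in>R. u k * A k l)"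
  proof (rule farkas_lemma[of L R A C])
    fix x :: "('a + 'b) option \<Rightarrow> real"
    assume x: "\<And>k. k \<in> R \<Longrightarrow> (\<Sum>l\<in>L. A k l * x l) \<le> 0"
    define \<alpha> where "\<alpha> i = x (Some (Inl i))" for i
    define \<beta> where "\<beta> j = x (Some (Inr j))" for j
    define \<tau> where "\<tau> = x None"
    have \<tau>: "\<tau> \<ge> 0" using x[of None] by (simp add: R_def sum_L A_def \<tau>_def)
    have feas: "\<alpha> i - \<beta> j \<le> \<tau> * c i j" if "i \<in> I" "j \<in> J" for i j
    proof -
      have "(\<Sum>l\<in>L. A (Some (i, j)) l * x l) = - c i j * \<tau> + \<alpha> i - \<beta> j"
        using that fin by (simp add: sum_L A_def \<alpha>_def \<beta>_def \<tau>_def if_distrib[of "\<lambda>t. t * _"] cong: if_cong)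
      then show ?thesis using x[of "Some (i, j)"] that by (simp add: R_def mult.commute)
    qed
    have "(\<Sum>i\<in>I. \<alpha> i * p i) - (\<Sum>j\<in>J. \<beta> j * q j) \<le> \<tau> * V"
    proof (cases "\<tau> = 0")
      case True
      \<comment> \<open>At scale 0 every \<open>\<alpha> i\<close> lies below every
        \<open>\<beta> j\<close>, so the constant \<open>m\<close> separates them; equality of the
        two total masses then gives the claim.\<close>
      have "I \<noteq> {}" using p(2) by auto
      define m where "m = Max (\<alpha> ` I)"
      have "m \<in> \<alpha> ` I" unfolding m_def using fin \<open>I \<noteq> {}\<close> by (intro Max_in) auto
      then have \<beta>: "m \<le> \<beta> j" if "j \<in> J" for j using feas[OF _ that] True by auto
      have \<alpha>: "\<alpha> i \<le> m" if "i \<in> I" for i unfolding m_def using fin that by auto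
      have "(\<Sum>i\<in>I. \<alpha> i * p i) \<le> (\<Sum>i\<in>I. m * p i)"
        using \<alpha> p by (intro sum_mono mult_right_mono) auto
      also have "\<dots> = (\<Sum>j\<in>J. m * q j)" using p q by (simp add: sum_distrib_left[symmetric])
      also have "\<dots> \<le> (\<Sum>j\<in>J. \<beta> j * q j)"
        using \<beta> q by (intro sum_mono mult_right_mono) auto
      finally show ?thesis using True by simp
    next
      case False
      then have "\<tau> > 0" using \<tau> by simp
      have "(\<Sum>i\<in>I. \<alpha> i / \<tau> * p i) - (\<Sum>j\<in>J. \<beta> j / \<tau> * q j) \<le> V"
        using feas \<open>\<tau> > 0\<close> by (intro dual) (simp add: diff_divide_distrib[symmetric] divide_le_eq mult.commute)
      then have "((\<Sum>i\<in>I. \<alpha> i * p i) - (\<Sum>j\<in>J. \<beta> j * q j)) / \<tau> \<le> V"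
        by (simp add: diff_divide_distrib sum_divide_distrib)
      then show ?thesis using \<open>\<tau> > 0\<close> by (simp add: divide_le_eq mult.commute)
    qed
    then show "(\<Sum>l\<in>L. C l * x l) \<le> 0"
      by (simp add: sum_L C_def \<alpha>_def \<beta>_def \<tau>_def sum_negf mult.commute)
  next
    show "finite L" "finite R" using fin by (simp_all add: L_def R_def)
  qed blast
  show ?thesis
  proof (rule that[of "\<lambda>i j. u (Some (i, j))"])
    fix i assume i: "i \<in> I"
    have "p i = (\<Sum>i'\<in>I. \<Sum>j\<in>J. u (Some (i', j)) * (if i = i' then 1 else 0))"
      using u(2)[of "Some (Inl i)"] i by (simp add: L_in C_def sum_R A_def)
    also have "\<dots> = (\<Sum>i'\<in>I. if i = i' then (\<Sum>j\<in>J. u (Some (i', j))) else 0)"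
      by (intro sum.cong) auto
    finally show "(\<Sum>j\<in>J. u (Some (i, j))) = p i" using fin i by simp
  next
    fix j assume j: "j \<in> J"
    have "- q j = (\<Sum>i\<in>I. \<Sum>j'\<in>J. u (Some (i, j')) * (if j = j' then - 1 else 0))"
      using u(2)[of "Some (Inr j)"] j by (simp add: L_in C_def sum_R A_def)
    also have "\<dots> = - (\<Sum>i\<in>I. u (Some (i, j)))"
      using fin j by (simp add: if_distrib[of "\<lambda>t. _ * t"] sum_negf cong: if_cong)
    finally show "(\<Sum>i\<in>I. u (Some (i, j))) = q j" by simp
  next
    \<comment> \<open>The column of \<tau> states the cost bound, with the multiplier of
      \<open>\<tau> \<ge> 0\<close> as slack.\<close>
    have "V = u None + (\<Sum>i\<in>I. \<Sum>j\<in>J. u (Some (i, j)) * c i j)"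
      using u(2)[of None] by (simp add: L_def C_def sum_R A_def sum_negf)
    moreover have "u None \<ge> 0" using u(1) by (simp add: R_def)
    ultimately show "(\<Sum>i\<in>I. \<Sum>j\<in>J. u (Some (i, j)) * c i j) \<le> V" by simp
  qed (use u(1) in \<open>auto simp: R_def\<close>)
qed

section \<open>Maps of finite range and the lifting of discrete plans\<close>

lemma nn_integral_finite_range:
  assumes "T \<in> measurable M borel" "finite I" "\<And>x. x \<in> space M \<Longrightarrow> T x \<in> (I :: 'a::t1_space set)"
  shows "(\<integral>\<^sup>+x. g (T x) \<partial>M) = (\<Sum>i\<in>I. g i * emeasure M (T -` {i} \<inter> space M))"
proof -
  note [measurable] = assms(1)
  have "(\<integral>\<^sup>+x. g (T x) \<partial>M) = (\<integral>\<^sup>+x. (\<Sum>i\<in>I. g i * indicator (T -` {i} \<inter> space M) x) \<partial>M)"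
  proof (rule nn_integral_cong)
    fix x assume x: "x \<in> space M"
    have "(\<Sum>i\<in>I. g i * indicator (T -` {i} \<inter> space M) x) = (\<Sum>i\<in>I. if T x = i then g i else 0)"
      using x by (intro sum.cong) (auto simp: indicator_def)
    then show "g (T x) = (\<Sum>i\<in>I. g i * indicator (T -` {i} \<inter> space M) x)"
      using assms x by simp
  qed
  also have "\<dots> = (\<Sum>i\<in>I. g i * emeasure M (T -` {i} \<inter> space M))"
    by (subst nn_integral_sum) (auto simp: nn_integral_cmult_indicator)
  finally show ?thesis .
qed

lemma integral_finite_range:
  fixes g :: "'a::t1_space \<Rightarrow> real"
  assumes "finite_measure M" "T \<in> measurable M borel" "finite I" "\<And>x. x \<in> space M \<Longrightarrow> T x \<in> I"
  shows "integrable M (\<lambda>x. g (T x))"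
    and "(\<integral>x. g (T x) \<partial>M) = (\<Sum>i\<in>I. g i * measure M (T -` {i} \<inter> space M))"
proof -
  interpret finite_measure M by fact
  note [measurable] = assms(2)
  have eq: "g (T x) = (\<Sum>i\<in>I. g i * indicator (T -` {i} \<inter> space M) x)" if x: "x \<in> space M" for x
  proof -
    have "(\<Sum>i\<in>I. g i * indicator (T -` {i} \<inter> space M) x) = (\<Sum>i\<in>I. if T x = i then g i else 0)"
      using x by (intro sum.cong) (auto simp: indicator_def)
    then show ?thesis using assms x by simp
  qed
  have int: "integrable M (\<lambda>x. g i * indicator (T -` {i} \<inter> space M) x)" for i
    by (intro integrable_mult_right integrable_real_indicator) (auto simp: emeasure_eq_measure)
  then have "integrable M (\<lambda>x. \<Sum>i\<in>I. g i * indicator (T -` {i} \<inter> space M) x)"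
    by (intro Bochner_Integration.integrable_sum)
  moreover have "integrable M (\<lambda>x. g (T x))
      \<longleftrightarrow> integrable M (\<lambda>x. \<Sum>i\<in>I. g i * indicator (T -` {i} \<inter> space M) x)"
    by (rule Bochner_Integration.integrable_cong[OF refl eq])
  ultimately show "integrable M (\<lambda>x. g (T x))" by blast
  have "(\<integral>x. g (T x) \<partial>M) = (\<integral>x. (\<Sum>i\<in>I. g i * indicator (T -` {i} \<inter> space M) x) \<partial>M)"
    by (rule Bochner_Integration.integral_cong[OF refl eq])
  also have "\<dots> = (\<Sum>i\<in>I. g i * measure M (T -` {i} \<inter> space M))"
    using int by (subst Bochner_Integration.integral_sum) auto
  finally show "(\<integral>x. g (T x) \<partial>M) = (\<Sum>i\<in>I. g i * measure M (T -` {i} \<inter> space M))" .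
qed

lemma density_pair_measure_coupling:
  fixes \<nu> \<mu> :: "'a::polish_space measure"
  assumes \<nu>: "prob_space \<nu>" "sets \<nu> = sets borel" and \<mu>: "prob_space \<mu>" "sets \<mu> = sets borel"
    and W: "W \<in> borel_measurable (borel \<Otimes>\<^sub>M borel)"
    and 1: "AE x in \<nu>. (\<integral>\<^sup>+y. W (x, y) \<partial>\<mu>) = 1" and 2: "AE y in \<mu>. (\<integral>\<^sup>+x. W (x, y) \<partial>\<nu>) = 1"
  shows "density (\<nu> \<Otimes>\<^sub>M \<mu>) W \<in> couplings \<nu> \<mu>"
proof -
  interpret N: prob_space \<nu> by fact
  interpret M: prob_space \<mu> by fact
  interpret pair_prob_space \<nu> \<mu> by unfold_locales
  have sets_eq: "sets (\<nu> \<Otimes>\<^sub>M \<mu>) = sets (borel \<Otimes>\<^sub>M borel)"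
    using \<nu> \<mu> by (intro sets_pair_measure_cong)
  have [measurable]: "W \<in> borel_measurable (\<nu> \<Otimes>\<^sub>M \<mu>)"
    using W sets_eq by (simp cong: measurable_cong_sets)
  have m: "A \<in> sets \<nu>" "A \<in> sets \<mu>" if "A \<in> sets borel" for A using that \<nu> \<mu> by auto
  have mf: "fst \<in> measurable (\<nu> \<Otimes>\<^sub>M \<mu>) borel" "snd \<in> measurable (\<nu> \<Otimes>\<^sub>M \<mu>) borel"
    using measurable_fst[of \<nu> \<mu>] measurable_snd[of \<nu> \<mu>] \<nu> \<mu> by (simp_all cong: measurable_cong_sets)
  have d1: "distr (density (\<nu> \<Otimes>\<^sub>M \<mu>) W) borel fst = \<nu>"
  proof (rule measure_eqI)
    fix A assume "A \<in> sets (distr (density (\<nu> \<Otimes>\<^sub>M \<mu>) W) borel fst)"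
    then have A: "A \<in> sets borel" by simp
    note [measurable] = m[OF A]
    have "emeasure (distr (density (\<nu> \<Otimes>\<^sub>M \<mu>) W) borel fst) A
        = (\<integral>\<^sup>+z. W z * indicator (fst -` A \<inter> space (\<nu> \<Otimes>\<^sub>M \<mu>)) z \<partial>(\<nu> \<Otimes>\<^sub>M \<mu>))"
      using A mf measurable_sets[OF mf(1) A] by (simp add: emeasure_distr emeasure_density)
    also have "\<dots> = (\<integral>\<^sup>+z. W z * indicator A (fst z) \<partial>(\<nu> \<Otimes>\<^sub>M \<mu>))"
      by (intro nn_integral_cong) (auto simp: indicator_def)
    also have "\<dots> = (\<integral>\<^sup>+x. (\<integral>\<^sup>+y. W (x, y) * indicator A x \<partial>\<mu>) \<partial>\<nu>)"
      by (subst M.nn_integral_fst[symmetric]) auto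
    also have "\<dots> = (\<integral>\<^sup>+x. (\<integral>\<^sup>+y. W (x, y) \<partial>\<mu>) * indicator A x \<partial>\<nu>)"
      by (intro nn_integral_cong nn_integral_multc) measurable
    also have "\<dots> = (\<integral>\<^sup>+x. indicator A x \<partial>\<nu>)"
      by (intro nn_integral_cong_AE) (use 1 in eventually_elim, simp)
    finally show "emeasure (distr (density (\<nu> \<Otimes>\<^sub>M \<mu>) W) borel fst) A = emeasure \<nu> A" by simp
  qed (simp add: \<nu>)
  have d2: "distr (density (\<nu> \<Otimes>\<^sub>M \<mu>) W) borel snd = \<mu>"
  proof (rule measure_eqI)
    fix A assume "A \<in> sets (distr (density (\<nu> \<Otimes>\<^sub>M \<mu>) W) borel snd)"
    then have A: "A \<in> sets borel" by simp
    note [measurable] = m[OF A]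
    have "emeasure (distr (density (\<nu> \<Otimes>\<^sub>M \<mu>) W) borel snd) A
        = (\<integral>\<^sup>+z. W z * indicator (snd -` A \<inter> space (\<nu> \<Otimes>\<^sub>M \<mu>)) z \<partial>(\<nu> \<Otimes>\<^sub>M \<mu>))"
      using A mf measurable_sets[OF mf(2) A] by (simp add: emeasure_distr emeasure_density)
    also have "\<dots> = (\<integral>\<^sup>+z. W z * indicator A (snd z) \<partial>(\<nu> \<Otimes>\<^sub>M \<mu>))"
      by (intro nn_integral_cong) (auto simp: indicator_def)
    also have "\<dots> = (\<integral>\<^sup>+y. (\<integral>\<^sup>+x. W (x, y) * indicator A y \<partial>\<nu>) \<partial>\<mu>)"
      by (subst nn_integral_snd[symmetric]) (auto simp: case_prod_unfold)
    also have "\<dots> = (\<integral>\<^sup>+y. (\<integral>\<^sup>+x. W (x, y) \<partial>\<nu>) * indicator A y \<partial>\<mu>)"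
      by (intro nn_integral_cong nn_integral_multc) measurable
    also have "\<dots> = (\<integral>\<^sup>+y. indicator A y \<partial>\<mu>)"
      by (intro nn_integral_cong_AE) (use 2 in eventually_elim, simp)
    finally show "emeasure (distr (density (\<nu> \<Otimes>\<^sub>M \<mu>) W) borel snd) A = emeasure \<mu> A" by simp
  qed (simp add: \<mu>)
  \<comment> \<open>The total mass is read off from the first marginal.\<close>
  have "prob_space (density (\<nu> \<Otimes>\<^sub>M \<mu>) W)"
  proof (rule prob_space_distrD)
    show "fst \<in> measurable (density (\<nu> \<Otimes>\<^sub>M \<mu>) W) borel" using mf by simp
    show "prob_space (distr (density (\<nu> \<Otimes>\<^sub>M \<mu>) W) borel fst)" unfolding d1 by fact
  qed
  then show ?thesis using d1 d2 sets_eq by (simp add: couplings_def)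
qed

text \<open>The maps are chosen independently of the measure, and the estimate holds eventually, so
  that a single \<open>T N\<close> can serve both marginals. A point goes to the first member of a
  dense sequence within distance \<delta> if its index is at most \<open>N\<close>, and to
  \<open>x0\<close> otherwise; the second moment dominates the error of the far points.\<close>

lemma quantization:
  fixes x0 :: "'a::polish_space" and \<epsilon> :: real
  assumes "\<epsilon> > 0"
  obtains T :: "nat \<Rightarrow> 'a \<Rightarrow> 'a"
  where "\<And>N. T N \<in> measurable borel borel" "\<And>N. finite (range (T N))"
    "\<And>\<mu> :: 'a measure. \<lbrakk>prob_space \<mu>; sets \<mu> = sets borel; integrable \<mu> (\<lambda>x. (dist x x0)\<^sup>2)\<rbrakk>
      \<Longrightarrow> \<forall>\<^sub>F N in sequentially. integrable \<mu> (\<lambda>x. (dist x (T N x))\<^sup>2) \<and> (\<integral>x. (dist x (T N x))\<^sup>2 \<partial>\<mu>) < \<epsilon>"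
proof -
  obtain D :: "'a set" where D: "countable D" "\<And>X. open X \<Longrightarrow> X \<noteq> {} \<Longrightarrow> \<exists>d\<in>D. d \<in> X"
    using countable_dense_exists by blast
  have "D \<noteq> {}" using D(2)[of UNIV] by auto
  define d where "d = from_nat_into D"
  define \<delta> where "\<delta> = sqrt (\<epsilon> / 2)"
  have \<delta>: "\<delta> > 0" "\<delta>\<^sup>2 < \<epsilon>" using assms by (auto simp: \<delta>_def)
  have ex: "\<exists>k. dist x (d k) < \<delta>" for x
  proof -
    obtain y where "y \<in> D" "y \<in> ball x \<delta>" using D(2)[of "ball x \<delta>"] \<delta> by auto
    then show ?thesis using from_nat_into_surj[OF D(1)] unfolding d_def by (metis mem_ball)
  qed
  define k where "k x = (LEAST k. dist x (d k) < \<delta>)" for x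
  have k: "dist x (d (k x)) < \<delta>" for x unfolding k_def by (rule LeastI_ex[OF ex])
  have [measurable]: "k \<in> measurable borel (count_space UNIV)" unfolding k_def by measurable
  define T where "T N x = (if k x \<le> N then d (k x) else x0)" for N x
  have T_meas: "T N \<in> measurable borel borel" for N
    unfolding T_def by measurable
  have T_fin: "finite (range (T N))" for N
    by (rule finite_subset[of _ "insert x0 (d ` {..N})"]) (auto simp: T_def)
  have "\<forall>\<^sub>F N in sequentially. integrable \<mu> (\<lambda>x. (dist x (T N x))\<^sup>2) \<and> (\<integral>x. (dist x (T N x))\<^sup>2 \<partial>\<mu>) < \<epsilon>"
    if \<mu>: "prob_space \<mu>" "sets \<mu> = sets borel" and int: "integrable \<mu> (\<lambda>x. (dist x x0)\<^sup>2)" for \<mu> :: "'a measure"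
  proof -
    interpret prob_space \<mu> by fact
    note [measurable_cong] = \<mu>(2)
    note [measurable] = T_meas
    have dk: "(dist x (d (k x)))\<^sup>2 \<le> \<delta>\<^sup>2" for x using k[of x] by (intro power_mono) auto
    have iw: "integrable \<mu> (\<lambda>x. \<delta>\<^sup>2 + (dist x x0)\<^sup>2)" using int by simp
    have bound: "norm ((dist x (T N x))\<^sup>2) \<le> \<delta>\<^sup>2 + (dist x x0)\<^sup>2" for N x
      using dk[of x] by (auto simp: T_def intro: add_increasing2)
    have iT: "integrable \<mu> (\<lambda>x. (dist x (T N x))\<^sup>2)" for N
      by (rule Bochner_Integration.integrable_bound[OF iw]) (use bound[of _ N] in auto)
    have "(\<lambda>N. \<integral>x. (dist x (T N x))\<^sup>2 \<partial>\<mu>) \<longlonglongrightarrow> (\<integral>x. (dist x (d (k x)))\<^sup>2 \<partial>\<mu>)"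
    proof (rule integral_dominated_convergence[OF _ _ iw])
      have "(\<lambda>N. (dist x (T N x))\<^sup>2) \<longlonglongrightarrow> (dist x (d (k x)))\<^sup>2" for x
        by (rule tendsto_eventually, rule eventually_mono[OF eventually_ge_at_top[of "k x"]]) (simp add: T_def)
      then show "AE x in \<mu>. (\<lambda>N. (dist x (T N x))\<^sup>2) \<longlonglongrightarrow> (dist x (d (k x)))\<^sup>2" by simp
    qed (use bound in auto)
    moreover have "(\<integral>x. (dist x (d (k x)))\<^sup>2 \<partial>\<mu>) \<le> (\<integral>x. \<delta>\<^sup>2 \<partial>\<mu>)"
    proof (rule integral_mono)
      show "integrable \<mu> (\<lambda>x. (dist x (d (k x)))\<^sup>2)"
        by (rule integrable_const_bound[where B = "\<delta>\<^sup>2"]) (use dk in auto)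
    qed (use dk in auto)
    moreover have "(\<integral>x. \<delta>\<^sup>2 \<partial>\<mu>) < \<epsilon>" using \<delta>(2) by (simp add: prob_space)
    ultimately have "\<forall>\<^sub>F N in sequentially. (\<integral>x. (dist x (T N x))\<^sup>2 \<partial>\<mu>) < \<epsilon>"
      by (elim order_tendstoD(2)) linarith
    then show ?thesis using iT by simp
  qed
  then show ?thesis using that[of T] T_meas T_fin by blast
qed

text \<open>The exceptional points lie in finitely many null fibres. This justifies dividing by cell
  masses almost everywhere.\<close>

lemma AE_finite_range_fibre_pos:
  assumes "T \<in> measurable M borel" "finite I" "\<And>x. T x \<in> (I :: 'a::t1_space set)"
  shows "AE x in M. emeasure M (T -` {T x} \<inter> space M) \<noteq> 0"
proof -
  note [measurable] = assms(1)
  have "AE x in M. T x = i \<longrightarrow> emeasure M (T -` {i} \<inter> space M) \<noteq> 0" for i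
  proof (cases "emeasure M (T -` {i} \<inter> space M) = 0")
    case True
    then have "AE x in M. x \<notin> T -` {i} \<inter> space M" by (intro AE_not_in null_setsI) auto
    then show ?thesis using AE_space by eventually_elim auto
  qed simp
  then have "AE x in M. \<forall>i\<in>I. T x = i \<longrightarrow> emeasure M (T -` {i} \<inter> space M) \<noteq> 0"
    using assms(2) by (intro AE_finite_allI)
  then show ?thesis by eventually_elim (use assms(3) in blast)
qed

text \<open>In the density below, 0 / 0 = 0 is the right value, since the plan vanishes on cells of measure zero.\<close>
lemma finite_transport_coupling:
  fixes \<nu> \<mu> :: "'a::polish_space measure" and T :: "'a \<Rightarrow> 'a" and c :: "'a \<Rightarrow> 'a \<Rightarrow> real"
  assumes \<nu>: "prob_space \<nu>" "sets \<nu> = sets borel" and \<mu>: "prob_space \<mu>" "sets \<mu> = sets borel"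
    and T: "T \<in> measurable borel borel" "finite I" "range T \<subseteq> I"
    and c: "\<And>i j. 0 \<le> c i j"
    and \<pi>: "\<And>i j. i \<in> I \<Longrightarrow> j \<in> I \<Longrightarrow> 0 \<le> \<pi> i j"
      "\<And>i. i \<in> I \<Longrightarrow> (\<Sum>j\<in>I. \<pi> i j) = measure \<nu> (T -` {i})"
      "\<And>j. j \<in> I \<Longrightarrow> (\<Sum>i\<in>I. \<pi> i j) = measure \<mu> (T -` {j})"
  obtains \<xi> where "\<xi> \<in> couplings \<nu> \<mu>"
    "(\<integral>\<^sup>+z. ennreal (c (T (fst z)) (T (snd z))) \<partial>\<xi>) \<le> ennreal (\<Sum>i\<in>I. \<Sum>j\<in>I. \<pi> i j * c i j)"
proof -
  interpret N: prob_space \<nu> by fact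
  interpret M: prob_space \<mu> by fact
  interpret pair_prob_space \<nu> \<mu> by unfold_locales
  have sets_eq: "sets (\<nu> \<Otimes>\<^sub>M \<mu>) = sets (borel \<Otimes>\<^sub>M borel)"
    using \<nu> \<mu> by (intro sets_pair_measure_cong)
  note [measurable] = T(1)
  have sp [simp]: "space \<nu> = UNIV" "space \<mu> = UNIV"
    using sets_eq_imp_space_eq[OF \<nu>(2)] sets_eq_imp_space_eq[OF \<mu>(2)] by simp_all
  have TN: "T \<in> measurable \<nu> borel" by (subst measurable_cong_sets[OF \<nu>(2) refl]) measurable
  have TM: "T \<in> measurable \<mu> borel" by (subst measurable_cong_sets[OF \<mu>(2) refl]) measurable
  have TI: "T x \<in> I" for x using T(3) by auto
  define p where "p i = measure \<nu> (T -` {i})" for i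
  define q where "q j = measure \<mu> (T -` {j})" for j
  have p: "emeasure \<nu> (T -` {i}) = ennreal (p i)" "0 \<le> p i" for i by (simp_all add: p_def N.emeasure_eq_measure)
  have q: "emeasure \<mu> (T -` {i}) = ennreal (q i)" "0 \<le> q i" for i by (simp_all add: q_def M.emeasure_eq_measure)
  \<comment> \<open>The mass \<open>\<pi> i j\<close> is spread over the product of cells
    \<open>i\<close> and \<open>j\<close> proportionally to the product measure, which restores the
    marginals \<nu> and \<mu> inside each cell.\<close>
  define w where "w i j = \<pi> i j / (p i * q j)" for i j
  have w0: "0 \<le> w i j" if "i \<in> I" "j \<in> I" for i j using \<pi>(1) that p q by (simp add: w_def)
  have \<pi>0: "\<pi> i j = 0" if "i \<in> I" "j \<in> I" "p i = 0 \<or> q j = 0" for i j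
  proof -
    have "\<pi> i j \<le> (\<Sum>j\<in>I. \<pi> i j)" "\<pi> i j \<le> (\<Sum>i\<in>I. \<pi> i j)"
      using that \<pi>(1) T(2) by (intro member_le_sum; simp)+
    then show ?thesis using that \<pi> by (auto simp: p_def q_def intro: antisym)
  qed
  have wpq: "w i j * p i * q j = \<pi> i j" if "i \<in> I" "j \<in> I" for i j
    using \<pi>0[OF that] by (auto simp: w_def)
  define W where "W z = ennreal (w (T (fst z)) (T (snd z)))" for z
  \<comment> \<open>Since \<open>T\<close> has finite range and singletons are Borel, every function
    of the two cell labels is a finite combination of measurable indicators.\<close>
  have fin_meas: "(\<lambda>z. g (T (fst z)) (T (snd z))) \<in> borel_measurable (borel \<Otimes>\<^sub>M borel)"
    for g :: "'a \<Rightarrow> 'a \<Rightarrow> ennreal"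
  proof -
    have "g (T (fst z)) (T (snd z)) =
        (\<Sum>i\<in>I. \<Sum>j\<in>I. g i j * (indicator {i} (T (fst z)) * indicator {j} (T (snd z))))" for z
    proof -
      have "(\<Sum>i\<in>I. \<Sum>j\<in>I. g i j * (indicator {i} (T (fst z)) * indicator {j} (T (snd z))))
          = (\<Sum>i\<in>I. \<Sum>j\<in>I. if T (snd z) = j then (if T (fst z) = i then g i j else 0) else 0)"
        by (intro sum.cong refl) (auto simp: indicator_def)
      also have "\<dots> = (\<Sum>i\<in>I. if T (fst z) = i then g i (T (snd z)) else 0)"
        using T(2) TI by (intro sum.cong refl) simp
      also have "\<dots> = g (T (fst z)) (T (snd z))" using T(2) TI by simp
      finally show ?thesis by simp
    qed
    then show ?thesis by simp
  qed
  have W_meas: "W \<in> borel_measurable (borel \<Otimes>\<^sub>M borel)"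
    unfolding W_def by (rule fin_meas)
  have inner_M: "(\<integral>\<^sup>+y. ennreal (g (T x) (T y)) \<partial>\<mu>) = ennreal (\<Sum>j\<in>I. g (T x) j * q j)"
    if "\<And>j. j \<in> I \<Longrightarrow> 0 \<le> g (T x) j" for g :: "'a \<Rightarrow> 'a \<Rightarrow> real" and x
    using nn_integral_finite_range[OF TM T(2), of "\<lambda>j. ennreal (g (T x) j)"] TI that q(2)
    by (simp add: q(1) ennreal_mult[symmetric] sum_ennreal)
  have inner_N: "(\<integral>\<^sup>+x. ennreal (g (T x)) \<partial>\<nu>) = ennreal (\<Sum>i\<in>I. g i * p i)"
    if "\<And>i. i \<in> I \<Longrightarrow> 0 \<le> g i" for g :: "'a \<Rightarrow> real"
    using nn_integral_finite_range[OF TN T(2), of "\<lambda>i. ennreal (g i)"] TI that p(2)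
    by (simp add: p(1) ennreal_mult[symmetric] sum_ennreal)
  have null: "AE x in \<nu>. p (T x) \<noteq> 0" "AE y in \<mu>. q (T y) \<noteq> 0"
    using AE_finite_range_fibre_pos[OF TN T(2) TI] AE_finite_range_fibre_pos[OF TM T(2) TI]
    by (auto simp: p(1) q(1) elim!: eventually_mono)
  have 1: "AE x in \<nu>. (\<integral>\<^sup>+y. W (x, y) \<partial>\<mu>) = 1"
    using null(1)
  proof eventually_elim
    case (elim x)
    have "(\<Sum>j\<in>I. w (T x) j * q j) * p (T x) = (\<Sum>j\<in>I. \<pi> (T x) j)"
      unfolding sum_distrib_right by (intro sum.cong refl) (simp add: wpq[OF TI, symmetric] mult_ac)
    then have "(\<Sum>j\<in>I. w (T x) j * q j) = 1" using \<pi>(2)[OF TI] elim by (simp add: p_def)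
    then show ?case using inner_M[of w x] w0 TI by (simp add: W_def)
  qed
  have 2: "AE y in \<mu>. (\<integral>\<^sup>+x. W (x, y) \<partial>\<nu>) = 1"
    using null(2)
  proof eventually_elim
    case (elim y)
    have "(\<Sum>i\<in>I. w i (T y) * p i) * q (T y) = (\<Sum>i\<in>I. \<pi> i (T y))"
      unfolding sum_distrib_right by (intro sum.cong refl) (simp add: wpq[OF _ TI, symmetric] mult_ac)
    then have "(\<Sum>i\<in>I. w i (T y) * p i) = 1" using \<pi>(3)[OF TI] elim by (simp add: q_def)
    then show ?case using inner_N[of "\<lambda>i. w i (T y)"] w0 TI by (simp add: W_def)
  qed
  show ?thesis
  proof (rule that)
    show "density (\<nu> \<Otimes>\<^sub>M \<mu>) W \<in> couplings \<nu> \<mu>"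
      using density_pair_measure_coupling[OF \<nu> \<mu> W_meas 1 2] .
    have [measurable]: "W \<in> borel_measurable (\<nu> \<Otimes>\<^sub>M \<mu>)"
      "(\<lambda>z. ennreal (c (T (fst z)) (T (snd z)))) \<in> borel_measurable (\<nu> \<Otimes>\<^sub>M \<mu>)"
      unfolding measurable_cong_sets[OF sets_eq refl] by (rule W_meas, rule fin_meas)
    have "(\<integral>\<^sup>+z. ennreal (c (T (fst z)) (T (snd z))) \<partial>density (\<nu> \<Otimes>\<^sub>M \<mu>) W)
        = (\<integral>\<^sup>+z. W z * ennreal (c (T (fst z)) (T (snd z))) \<partial>(\<nu> \<Otimes>\<^sub>M \<mu>))"
      by (rule nn_integral_density) measurable
    also have "\<dots> = (\<integral>\<^sup>+x. \<integral>\<^sup>+y. W (x, y) * ennreal (c (T (fst (x, y))) (T (snd (x, y)))) \<partial>\<mu> \<partial>\<nu>)"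
      by (rule M.nn_integral_fst[symmetric]) measurable
    also have "\<dots> = (\<integral>\<^sup>+x. \<integral>\<^sup>+y. ennreal (w (T x) (T y) * c (T x) (T y)) \<partial>\<mu> \<partial>\<nu>)"
      by (simp add: W_def ennreal_mult w0 TI c)
    also have "\<dots> = (\<integral>\<^sup>+x. ennreal (\<Sum>j\<in>I. w (T x) j * c (T x) j * q j) \<partial>\<nu>)"
      using inner_M[of "\<lambda>i j. w i j * c i j"] w0 TI c by simp
    also have "\<dots> = ennreal (\<Sum>i\<in>I. (\<Sum>j\<in>I. w i j * c i j * q j) * p i)"
      by (rule inner_N) (intro sum_nonneg mult_nonneg_nonneg w0 c q)
    also have "(\<Sum>i\<in>I. (\<Sum>j\<in>I. w i j * c i j * q j) * p i) = (\<Sum>i\<in>I. \<Sum>j\<in>I. \<pi> i j * c i j)"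
      unfolding sum_distrib_right by (intro sum.cong refl) (simp add: wpq[symmetric] mult_ac)
    finally show "(\<integral>\<^sup>+z. ennreal (c (T (fst z)) (T (snd z))) \<partial>density (\<nu> \<Otimes>\<^sub>M \<mu>) W)
        \<le> ennreal (\<Sum>i\<in>I. \<Sum>j\<in>I. \<pi> i j * c i j)" by simp
  qed
qed

section \<open>Removing the quantization error\<close>

lemma square_sum3_le:
  fixes a b c \<theta> :: real
  assumes "\<theta> > 0"
  shows "(a + b + c)\<^sup>2 \<le> (1 + \<theta>) * a\<^sup>2 + 2 * (1 + 1 / \<theta>) * (b\<^sup>2 + c\<^sup>2)"
proof -
  \<comment> \<open>Young's inequality with weight \<theta> puts the loss on \<open>b\<close> and
    \<open>c\<close>, so the coefficient of the main term stays close to 1.\<close>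
  have "0 \<le> (\<theta> * a - (b + c))\<^sup>2 / \<theta>" using assms by simp
  also have "\<dots> = \<theta> * a\<^sup>2 + (b + c)\<^sup>2 / \<theta> - 2 * a * (b + c)"
    using assms by (simp add: field_simps power2_eq_square)
  finally have 1: "(a + b + c)\<^sup>2 \<le> (1 + \<theta>) * a\<^sup>2 + (1 + 1 / \<theta>) * (b + c)\<^sup>2"
    by (simp add: algebra_simps add_divide_distrib power2_eq_square)
  have "(b + c)\<^sup>2 \<le> 2 * (b\<^sup>2 + c\<^sup>2)"
    using zero_le_power2[of "b - c"] by (simp add: power2_eq_square algebra_simps)
  then have "(1 + 1 / \<theta>) * (b + c)\<^sup>2 \<le> (1 + 1 / \<theta>) * (2 * (b\<^sup>2 + c\<^sup>2))"
    using assms by (intro mult_left_mono) auto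
  with 1 have "(a + b + c)\<^sup>2 \<le> (1 + \<theta>) * a\<^sup>2 + (1 + 1 / \<theta>) * (2 * (b\<^sup>2 + c\<^sup>2))" by linarith
  then show ?thesis by (simp only: mult_ac)
qed

text \<open>Used in both directions: with quantized points on the left to turn discrete potentials
  into continuous ones, and with original points on the left to bound the cost of the lifted plan.
  The two uses account for the factor \<open>(1 + \<theta>)\<^sup>2\<close> in the final
  estimate.\<close>

lemma dist_square_quantized_le:
  fixes x y u v :: "'a::metric_space"
  assumes "\<theta> > 0"
  shows "(dist u v)\<^sup>2 \<le> (1 + \<theta>) * (dist x y)\<^sup>2 + 2 * (1 + 1 / \<theta>) * ((dist x u)\<^sup>2 + (dist y v)\<^sup>2)"
proof -
  have "dist u v \<le> dist x y + dist x u + dist y v"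
    using dist_triangle[of u v x] dist_triangle[of x v y] by (simp add: dist_commute)
  then have "(dist u v)\<^sup>2 \<le> (dist x y + dist x u + dist y v)\<^sup>2" by (intro power_mono) auto
  then show ?thesis using square_sum3_le[OF assms] by (rule order_trans)
qed

text \<open>Weak duality is transferred back to the whole space: a feasible discrete pair is
  composed with \<open>T\<close>, corrected by the quantization error and rescaled by
  \<open>1 + \<theta>\<close>, which makes it feasible for the true squared distance. Then
  \<open>dual\<close> applies.\<close>

lemma quantized_dual_le:
  fixes \<nu> \<mu> :: "'a::polish_space measure"
  assumes \<nu>: "prob_space \<nu>" "sets \<nu> = sets borel" and \<mu>: "prob_space \<mu>" "sets \<mu> = sets borel"
    and T: "T \<in> measurable borel borel" "finite I" "range T \<subseteq> I"
    and int: "integrable \<nu> (\<lambda>x. (dist x (T x))\<^sup>2)" "integrable \<mu> (\<lambda>x. (dist x (T x))\<^sup>2)"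
    and dual: "\<And>f M. f \<in> borel_measurable borel \<Longrightarrow> (\<And>x. \<bar>f x\<bar> \<le> M)
        \<Longrightarrow> (\<integral>x. inf_conv 1 f x \<partial>\<nu>) \<le> (\<integral>x. f x \<partial>\<mu>) + K"
    and \<theta>: "\<theta> > 0"
    and feas: "\<And>i j. i \<in> I \<Longrightarrow> j \<in> I \<Longrightarrow> \<alpha> i - \<beta> j \<le> (dist i j)\<^sup>2"
  shows "(\<Sum>i\<in>I. \<alpha> i * measure \<nu> (T -` {i})) - (\<Sum>j\<in>I. \<beta> j * measure \<mu> (T -` {j}))
    \<le> (1 + \<theta>) * K + 2 * (1 + 1 / \<theta>) * ((\<integral>x. (dist x (T x))\<^sup>2 \<partial>\<nu>) + (\<integral>x. (dist x (T x))\<^sup>2 \<partial>\<mu>))"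
proof -
  interpret N: prob_space \<nu> by fact
  interpret M: prob_space \<mu> by fact
  note [measurable] = T(1)
  have sp [simp]: "space \<nu> = UNIV" "space \<mu> = UNIV"
    using sets_eq_imp_space_eq[OF \<nu>(2)] sets_eq_imp_space_eq[OF \<mu>(2)] by simp_all
  have TN: "T \<in> measurable \<nu> borel" by (subst measurable_cong_sets[OF \<nu>(2) refl]) measurable
  have TM: "T \<in> measurable \<mu> borel" by (subst measurable_cong_sets[OF \<mu>(2) refl]) measurable
  have TI: "T x \<in> I" for x using T(3) by auto
  define \<kappa> where "\<kappa> = 2 * (1 + 1 / \<theta>)"
  have \<kappa>: "\<kappa> > 0" using \<theta> by (simp add: \<kappa>_def add_pos_pos)
  define a where "a x = (\<alpha> (T x) - \<kappa> * (dist x (T x))\<^sup>2) / (1 + \<theta>)" for x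
  define b where "b y = (\<beta> (T y) + \<kappa> * (dist y (T y))\<^sup>2) / (1 + \<theta>)" for y
  define B where "B = (\<Sum>i\<in>I. \<bar>\<alpha> i\<bar> + \<bar>\<beta> i\<bar>) / (1 + \<theta>)"
  have \<alpha>\<beta>: "(\<bar>\<alpha> i\<bar> + \<bar>\<beta> i\<bar>) / (1 + \<theta>) \<le> B" if "i \<in> I" for i
    unfolding B_def using that T(2) \<theta>
    by (intro divide_right_mono member_le_sum[of i I "\<lambda>i. \<bar>\<alpha> i\<bar> + \<bar>\<beta> i\<bar>"]) auto
  \<comment> \<open>\<open>b\<close> is unbounded because of its error term, whereas
    \<open>dual\<close> requires bounded functions. Truncation at \<open>B\<close> keeps feasibility
    since \<open>a x \<le> B\<close> and the squared distance is nonnegative, and it only lowers the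
    \<mu>-integral.\<close>
  define f where "f y = min (b y) B" for y
  have ab: "a x \<le> b y + (dist x y)\<^sup>2" for x y
  proof -
    have "\<alpha> (T x) - \<beta> (T y) \<le> (1 + \<theta>) * (dist x y)\<^sup>2 + \<kappa> * ((dist x (T x))\<^sup>2 + (dist y (T y))\<^sup>2)"
      using feas[OF TI TI, of x y] dist_square_quantized_le[OF \<theta>, of "T x" "T y" x y] unfolding \<kappa>_def by linarith
    then have "(\<alpha> (T x) - \<kappa> * (dist x (T x))\<^sup>2) / (1 + \<theta>)
        \<le> (\<beta> (T y) + \<kappa> * (dist y (T y))\<^sup>2 + (1 + \<theta>) * (dist x y)\<^sup>2) / (1 + \<theta>)"
      using \<theta> by (intro divide_right_mono) (auto simp: algebra_simps)
    also have "\<dots> = b y + (dist x y)\<^sup>2" using \<theta> by (simp add: b_def add_divide_distrib)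
    finally show ?thesis by (simp add: a_def)
  qed
  have aB: "a x \<le> B" for x
  proof -
    have "a x \<le> (\<bar>\<alpha> (T x)\<bar> + \<bar>\<beta> (T x)\<bar>) / (1 + \<theta>)"
      unfolding a_def using \<theta> \<kappa> mult_nonneg_nonneg[of \<kappa> "(dist x (T x))\<^sup>2"]
      by (intro divide_right_mono) (simp_all del: zero_le_mult_iff mult_nonneg_nonneg)
    then show ?thesis using \<alpha>\<beta>[OF TI, of x] by linarith
  qed
  have bB: "- B \<le> b y" for y
  proof -
    have "- ((\<bar>\<alpha> (T y)\<bar> + \<bar>\<beta> (T y)\<bar>) / (1 + \<theta>)) \<le> b y"
      unfolding b_def minus_divide_left using \<theta> \<kappa> mult_nonneg_nonneg[of \<kappa> "(dist y (T y))\<^sup>2"]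
      by (intro divide_right_mono) (simp_all del: zero_le_mult_iff mult_nonneg_nonneg)
    then show ?thesis using \<alpha>\<beta>[OF TI, of y] by linarith
  qed
  have "B \<ge> 0" using \<theta> by (simp add: B_def sum_nonneg)
  then have fB: "\<bar>f x\<bar> \<le> B" for x using bB[of x] by (auto simp: f_def)
  have ia: "integrable \<nu> a" "(\<integral>x. a x \<partial>\<nu>)
      = ((\<Sum>i\<in>I. \<alpha> i * measure \<nu> (T -` {i})) - \<kappa> * (\<integral>x. (dist x (T x))\<^sup>2 \<partial>\<nu>)) / (1 + \<theta>)"
    using int(1) integral_finite_range[OF N.finite_measure_axioms TN T(2), of \<alpha>] TI
    by (simp_all add: a_def[abs_def])
  have ib: "integrable \<mu> b" "(\<integral>x. b x \<partial>\<mu>)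
      = ((\<Sum>i\<in>I. \<beta> i * measure \<mu> (T -` {i})) + \<kappa> * (\<integral>x. (dist x (T x))\<^sup>2 \<partial>\<mu>)) / (1 + \<theta>)"
    using int(2) integral_finite_range[OF M.finite_measure_axioms TM T(2), of \<beta>] TI
    by (simp_all add: b_def[abs_def])
  have "b \<in> borel_measurable borel"
    using ib(1) measurable_cong_sets[OF \<mu>(2) refl] by blast
  then have f_meas: "f \<in> borel_measurable borel" unfolding f_def by measurable
  have "a x \<le> inf_conv 1 f x" for x
  proof (rule inf_conv_greatest)
    show "a x \<le> f y + 1 * (dist x y)\<^sup>2" for y
      using ab[of x y] add_increasing2[OF zero_le_power2[of "dist x y"] aB[of x]]
      by (simp add: f_def min_def)
  qed
  moreover have "integrable \<nu> (inf_conv 1 f)"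
    using \<nu> by (rule integrable_bounded_borel)
       (use inf_conv_measurable[of f B 1] inf_conv_bounded[of f B 1] fB in auto)
  ultimately have "(\<integral>x. a x \<partial>\<nu>) \<le> (\<integral>x. inf_conv 1 f x \<partial>\<nu>)"
    using ia by (intro integral_mono) auto
  also have "\<dots> \<le> (\<integral>x. f x \<partial>\<mu>) + K" using f_meas fB by (rule dual)
  also have "(\<integral>x. f x \<partial>\<mu>) \<le> (\<integral>x. b x \<partial>\<mu>)"
    using ib integrable_bounded_borel[OF \<mu> f_meas fB] by (intro integral_mono) (auto simp: f_def)
  finally have "(1 + \<theta>) * (\<integral>x. a x \<partial>\<nu>) \<le> (1 + \<theta>) * ((\<integral>x. b x \<partial>\<mu>) + K)"
    using \<theta> by (intro mult_left_mono) auto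
  moreover have "(1 + \<theta>) * (\<integral>x. a x \<partial>\<nu>) = (\<Sum>i\<in>I. \<alpha> i * measure \<nu> (T -` {i})) - \<kappa> * (\<integral>x. (dist x (T x))\<^sup>2 \<partial>\<nu>)"
    using \<theta> unfolding ia(2) by simp
  moreover have "(1 + \<theta>) * (\<integral>x. b x \<partial>\<mu>) = (\<Sum>i\<in>I. \<beta> i * measure \<mu> (T -` {i})) + \<kappa> * (\<integral>x. (dist x (T x))\<^sup>2 \<partial>\<mu>)"
    using \<theta> unfolding ib(2) by simp
  ultimately show ?thesis unfolding \<kappa>_def[symmetric] by (simp add: distrib_left)
qed

text \<open>The optimal discrete cost is at most
  \<open>V = (1 + \<theta>) * K + \<kappa> * (e \<nu> + e \<mu>)\<close>. Lifting the plan
  multiplies this by \<open>1 + \<theta>\<close> and adds the error term once more, whence the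
  factor \<open>2 + \<theta>\<close>.\<close>

lemma transport_cost2_quantized_le:
  fixes \<nu> \<mu> :: "'a::polish_space measure"
  assumes \<nu>: "prob_space \<nu>" "sets \<nu> = sets borel" and \<mu>: "prob_space \<mu>" "sets \<mu> = sets borel"
    and T: "T \<in> measurable borel borel" "finite (range T)"
    and int: "integrable \<nu> (\<lambda>x. (dist x (T x))\<^sup>2)" "integrable \<mu> (\<lambda>x. (dist x (T x))\<^sup>2)"
    and E: "(\<integral>x. (dist x (T x))\<^sup>2 \<partial>\<nu>) + (\<integral>x. (dist x (T x))\<^sup>2 \<partial>\<mu>) \<le> E"
    and dual: "\<And>f M. f \<in> borel_measurable borel \<Longrightarrow> (\<And>x. \<bar>f x\<bar> \<le> M)
        \<Longrightarrow> (\<integral>x. inf_conv 1 f x \<partial>\<nu>) \<le> (\<integral>x. f x \<partial>\<mu>) + K"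
    and \<theta>: "\<theta> > 0"
  shows "transport_cost2 \<nu> \<mu> \<le> ennreal ((1 + \<theta>)\<^sup>2 * K + (2 + \<theta>) * (2 * (1 + 1 / \<theta>) * E))"
proof -
  interpret N: prob_space \<nu> by fact
  interpret M: prob_space \<mu> by fact
  note [measurable] = T(1)
  have sp [simp]: "space \<nu> = UNIV" "space \<mu> = UNIV"
    using sets_eq_imp_space_eq[OF \<nu>(2)] sets_eq_imp_space_eq[OF \<mu>(2)] by simp_all
  have TN: "T \<in> measurable \<nu> borel" by (subst measurable_cong_sets[OF \<nu>(2) refl]) measurable
  have TM: "T \<in> measurable \<mu> borel" by (subst measurable_cong_sets[OF \<mu>(2) refl]) measurable
  define \<kappa> where "\<kappa> = 2 * (1 + 1 / \<theta>)"
  have \<kappa>: "\<kappa> > 0" using \<theta> by (simp add: \<kappa>_def add_pos_pos)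
  define I where "I = range T"
  have I: "finite I" "range T \<subseteq> I" "\<And>x. T x \<in> I" using T by (auto simp: I_def)
  define e where "e \<rho> = (\<integral>x. (dist x (T x))\<^sup>2 \<partial>\<rho>)" for \<rho> :: "'a measure"
  define V where "V = (1 + \<theta>) * K + \<kappa> * (e \<nu> + e \<mu>)"
  have s1: "(\<Sum>i\<in>I. measure \<nu> (T -` {i})) = 1" "(\<Sum>i\<in>I. measure \<mu> (T -` {i})) = 1"
    using integral_finite_range(2)[OF N.finite_measure_axioms TN I(1), of "\<lambda>_. 1"]
      integral_finite_range(2)[OF M.finite_measure_axioms TM I(1), of "\<lambda>_. 1"] I(3)
      N.prob_space M.prob_space by auto
  obtain \<pi> where \<pi>: "\<And>i j. i \<in> I \<Longrightarrow> j \<in> I \<Longrightarrow> 0 \<le> \<pi> i j"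
    "\<And>i. i \<in> I \<Longrightarrow> (\<Sum>j\<in>I. \<pi> i j) = measure \<nu> (T -` {i})"
    "\<And>j. j \<in> I \<Longrightarrow> (\<Sum>i\<in>I. \<pi> i j) = measure \<mu> (T -` {j})"
    and V: "(\<Sum>i\<in>I. \<Sum>j\<in>I. \<pi> i j * (dist i j)\<^sup>2) \<le> V"
  proof (rule finite_transport_duality[of I I "\<lambda>i. measure \<nu> (T -` {i})" "\<lambda>i. measure \<mu> (T -` {i})" "\<lambda>i j. (dist i j)\<^sup>2" V])
    fix \<alpha> \<beta> :: "'a \<Rightarrow> real"
    assume "\<And>i j. i \<in> I \<Longrightarrow> j \<in> I \<Longrightarrow> \<alpha> i - \<beta> j \<le> (dist i j)\<^sup>2"
    then show "(\<Sum>i\<in>I. \<alpha> i * measure \<nu> (T -` {i})) - (\<Sum>j\<in>I. \<beta> j * measure \<mu> (T -` {j})) \<le> V"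
      unfolding V_def e_def \<kappa>_def by (intro quantized_dual_le[OF \<nu> \<mu> T(1) I(1,2) int dual \<theta>])
  qed (use I s1 in auto)
  obtain \<xi> where \<xi>: "\<xi> \<in> couplings \<nu> \<mu>"
    "(\<integral>\<^sup>+z. ennreal ((dist (T (fst z)) (T (snd z)))\<^sup>2) \<partial>\<xi>) \<le> ennreal (\<Sum>i\<in>I. \<Sum>j\<in>I. \<pi> i j * (dist i j)\<^sup>2)"
    using finite_transport_coupling[OF \<nu> \<mu> T(1) I(1,2), of "\<lambda>i j. (dist i j)\<^sup>2" \<pi>] \<pi> by auto
  have sets_\<xi> [measurable_cong]: "sets \<xi> = sets (borel \<Otimes>\<^sub>M borel)"
    and d: "distr \<xi> borel fst = \<nu>" "distr \<xi> borel snd = \<mu>"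
    using \<xi>(1) by (auto simp: couplings_def)
  \<comment> \<open>\<open>ennreal\<close> truncates negative numbers to 0, so the arithmetic below
    needs this; it holds because \<open>V\<close> dominates a nonnegative discrete cost.\<close>
  have V0: "0 \<le> V" by (rule order_trans[OF _ V]) (intro sum_nonneg mult_nonneg_nonneg \<pi> zero_le_power2)
  have e0: "0 \<le> e \<nu>" "0 \<le> e \<mu>" by (simp_all add: e_def)
  have marg1: "(\<integral>\<^sup>+z. ennreal ((dist (fst z) (T (fst z)))\<^sup>2) \<partial>\<xi>) = ennreal (e \<nu>)"
  proof -
    have "(\<integral>\<^sup>+z. ennreal ((dist (fst z) (T (fst z)))\<^sup>2) \<partial>\<xi>) = (\<integral>\<^sup>+x. ennreal ((dist x (T x))\<^sup>2) \<partial>distr \<xi> borel fst)"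
      by (subst nn_integral_distr) measurable
    then show ?thesis using int(1) unfolding d e_def by (simp add: nn_integral_eq_integral)
  qed
  have marg2: "(\<integral>\<^sup>+z. ennreal ((dist (snd z) (T (snd z)))\<^sup>2) \<partial>\<xi>) = ennreal (e \<mu>)"
  proof -
    have "(\<integral>\<^sup>+z. ennreal ((dist (snd z) (T (snd z)))\<^sup>2) \<partial>\<xi>) = (\<integral>\<^sup>+x. ennreal ((dist x (T x))\<^sup>2) \<partial>distr \<xi> borel snd)"
      by (subst nn_integral_distr) measurable
    then show ?thesis using int(2) unfolding d e_def by (simp add: nn_integral_eq_integral)
  qed
  have "transport_cost2 \<nu> \<mu> \<le> (\<integral>\<^sup>+z. ennreal ((dist (fst z) (snd z))\<^sup>2) \<partial>\<xi>)"
    unfolding transport_cost2_def using \<xi>(1) by (rule INF_lower)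
  also have "\<dots> \<le> (\<integral>\<^sup>+z. ennreal (1 + \<theta>) * ennreal ((dist (T (fst z)) (T (snd z)))\<^sup>2)
      + (ennreal \<kappa> * ennreal ((dist (fst z) (T (fst z)))\<^sup>2) + ennreal \<kappa> * ennreal ((dist (snd z) (T (snd z)))\<^sup>2)) \<partial>\<xi>)"
  proof (rule nn_integral_mono)
    fix z
    have "(dist (fst z) (snd z))\<^sup>2 \<le> (1 + \<theta>) * (dist (T (fst z)) (T (snd z)))\<^sup>2
        + (\<kappa> * (dist (fst z) (T (fst z)))\<^sup>2 + \<kappa> * (dist (snd z) (T (snd z)))\<^sup>2)"
      using dist_square_quantized_le[OF \<theta>, of "fst z" "snd z" "T (fst z)" "T (snd z)"]
      by (simp add: \<kappa>_def dist_commute algebra_simps)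
    then show "ennreal ((dist (fst z) (snd z))\<^sup>2) \<le> ennreal (1 + \<theta>) * ennreal ((dist (T (fst z)) (T (snd z)))\<^sup>2)
      + (ennreal \<kappa> * ennreal ((dist (fst z) (T (fst z)))\<^sup>2) + ennreal \<kappa> * ennreal ((dist (snd z) (T (snd z)))\<^sup>2))"
      using \<theta> \<kappa> by (simp add: ennreal_mult[symmetric] ennreal_plus[symmetric] ennreal_leI del: ennreal_plus)
  qed
  also have "\<dots> = ennreal (1 + \<theta>) * (\<integral>\<^sup>+z. ennreal ((dist (T (fst z)) (T (snd z)))\<^sup>2) \<partial>\<xi>)
      + (ennreal \<kappa> * ennreal (e \<nu>) + ennreal \<kappa> * ennreal (e \<mu>))"
    unfolding marg1[symmetric] marg2[symmetric] by (simp add: nn_integral_add nn_integral_cmult)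
  also have "\<dots> \<le> ennreal (1 + \<theta>) * ennreal V + (ennreal \<kappa> * ennreal (e \<nu>) + ennreal \<kappa> * ennreal (e \<mu>))"
    by (intro add_right_mono mult_left_mono order_trans[OF \<xi>(2)] ennreal_leI V) simp
  also have "\<dots> = ennreal ((1 + \<theta>) * V + (\<kappa> * e \<nu> + \<kappa> * e \<mu>))"
    using \<theta> \<kappa> V0 e0 by (simp add: ennreal_mult[symmetric] ennreal_plus[symmetric] del: ennreal_plus)
  also have "(1 + \<theta>) * V + (\<kappa> * e \<nu> + \<kappa> * e \<mu>) = (1 + \<theta>)\<^sup>2 * K + (2 + \<theta>) * (\<kappa> * (e \<nu> + e \<mu>))"
    by (simp add: V_def power2_eq_square algebra_simps)
  also have "ennreal \<dots> \<le> ennreal ((1 + \<theta>)\<^sup>2 * K + (2 + \<theta>) * (\<kappa> * E))"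
    using E \<theta> \<kappa> unfolding e_def[symmetric] by (intro ennreal_leI add_left_mono mult_left_mono) auto
  finally show ?thesis by (simp add: \<kappa>_def)
qed

text \<open>The error factor contains \<open>1 / \<theta>\<close>, so \<theta> is fixed first and
  the quantization accuracy is then chosen in terms of it, making the total error exactly \<theta>.
  Finally \<theta> tends to 0.\<close>

lemma transport_cost2_le:
  fixes \<nu> \<mu> :: "'a::polish_space measure"
  assumes \<nu>: "prob_space \<nu>" "sets \<nu> = sets borel" and \<mu>: "prob_space \<mu>" "sets \<mu> = sets borel"
    and int: "integrable \<nu> (\<lambda>x. (dist x x0)\<^sup>2)" "integrable \<mu> (\<lambda>x. (dist x x0)\<^sup>2)"
    and dual: "\<And>f M. f \<in> borel_measurable borel \<Longrightarrow> (\<And>x. \<bar>f x\<bar> \<le> M)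
        \<Longrightarrow> (\<integral>x. inf_conv 1 f x \<partial>\<nu>) \<le> (\<integral>x. f x \<partial>\<mu>) + K"
  shows "transport_cost2 \<nu> \<mu> \<le> ennreal K"
proof -
  have *: "transport_cost2 \<nu> \<mu> \<le> ennreal ((1 + \<theta>)\<^sup>2 * K + \<theta>)" if \<theta>: "\<theta> > 0" for \<theta>
  proof -
    define \<gamma> where "\<gamma> = (2 + \<theta>) * (2 * (1 + 1 / \<theta>))"
    have \<gamma>: "\<gamma> > 0" using \<theta> by (simp add: \<gamma>_def add_pos_pos)
    define \<epsilon> where "\<epsilon> = \<theta> / \<gamma> / 2"
    have \<epsilon>: "\<epsilon> > 0" "\<gamma> * (2 * \<epsilon>) = \<theta>" using \<theta> \<gamma> by (auto simp: \<epsilon>_def)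
    obtain T :: "nat \<Rightarrow> 'a \<Rightarrow> 'a" where T: "\<And>N. T N \<in> measurable borel borel" "\<And>N. finite (range (T N))"
      and ev: "\<And>\<mu> :: 'a measure. \<lbrakk>prob_space \<mu>; sets \<mu> = sets borel; integrable \<mu> (\<lambda>x. (dist x x0)\<^sup>2)\<rbrakk>
      \<Longrightarrow> \<forall>\<^sub>F N in sequentially. integrable \<mu> (\<lambda>x. (dist x (T N x))\<^sup>2) \<and> (\<integral>x. (dist x (T N x))\<^sup>2 \<partial>\<mu>) < \<epsilon>"
      using quantization[OF \<epsilon>(1), of x0] by blast
    have "\<forall>\<^sub>F N in sequentially. (integrable \<nu> (\<lambda>x. (dist x (T N x))\<^sup>2) \<and> (\<integral>x. (dist x (T N x))\<^sup>2 \<partial>\<nu>) < \<epsilon>)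
      \<and> (integrable \<mu> (\<lambda>x. (dist x (T N x))\<^sup>2) \<and> (\<integral>x. (dist x (T N x))\<^sup>2 \<partial>\<mu>) < \<epsilon>)"
      using ev[OF \<nu> int(1)] ev[OF \<mu> int(2)] by (rule eventually_conj)
    then obtain N where N: "integrable \<nu> (\<lambda>x. (dist x (T N x))\<^sup>2)" "integrable \<mu> (\<lambda>x. (dist x (T N x))\<^sup>2)"
      "(\<integral>x. (dist x (T N x))\<^sup>2 \<partial>\<nu>) + (\<integral>x. (dist x (T N x))\<^sup>2 \<partial>\<mu>) \<le> 2 * \<epsilon>"
      unfolding eventually_sequentially by fastforce
    have "transport_cost2 \<nu> \<mu> \<le> ennreal ((1 + \<theta>)\<^sup>2 * K + (2 + \<theta>) * (2 * (1 + 1 / \<theta>) * (2 * \<epsilon>)))"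
      by (rule transport_cost2_quantized_le[OF \<nu> \<mu> T N dual \<theta>])
    also have "(2 + \<theta>) * (2 * (1 + 1 / \<theta>) * (2 * \<epsilon>)) = \<theta>"
      using \<epsilon>(2) unfolding \<gamma>_def by (simp only: mult.assoc)
    finally show ?thesis .
  qed
  have "((\<lambda>\<theta>. ennreal ((1 + \<theta>)\<^sup>2 * K + \<theta>)) \<longlongrightarrow> ennreal ((1 + 0)\<^sup>2 * K + 0)) (at_right 0)"
    by (intro tendsto_intros tendsto_ennrealI)
  moreover have "\<forall>\<^sub>F \<theta> in at_right 0. transport_cost2 \<nu> \<mu> \<le> ennreal ((1 + \<theta>)\<^sup>2 * K + \<theta>)"
    using eventually_at_right_less[of "0 :: real"] by eventually_elim (rule *)
  ultimately have "transport_cost2 \<nu> \<mu> \<le> ennreal ((1 + 0)\<^sup>2 * K + 0)"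
    by (rule tendsto_lowerbound) simp
  then show ?thesis by simp
qed

text \<open>Quantizing \<nu> at small cost requires its second moment, which is extracted from
  \<open>dual\<close> itself. The test functions are truncated squared distances to
  \<open>x0\<close>, for which half of the function lies below its infimal convolution; Fatou's
  lemma removes the truncation.\<close>

lemma second_moment_finite_of_dual:
  fixes \<nu> \<mu> :: "'a::polish_space measure"
  assumes \<nu>: "prob_space \<nu>" "sets \<nu> = sets borel" and \<mu>: "prob_space \<mu>" "sets \<mu> = sets borel"
    and int: "integrable \<mu> (\<lambda>x. (dist x x0)\<^sup>2)"
    and dual: "\<And>f M. f \<in> borel_measurable borel \<Longrightarrow> (\<And>x. \<bar>f x\<bar> \<le> M)
        \<Longrightarrow> (\<integral>x. inf_conv 1 f x \<partial>\<nu>) \<le> (\<integral>x. f x \<partial>\<mu>) + K"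
  shows "integrable \<nu> (\<lambda>x. (dist x x0)\<^sup>2)"
proof -
  interpret N: prob_space \<nu> by fact
  note [measurable_cong] = \<nu>(2) \<mu>(2)
  define g where "g n x = min ((dist x x0)\<^sup>2) (real n)" for n x
  have g: "\<bar>g n x\<bar> \<le> real n" for n x by (auto simp: g_def)
  have g0: "0 \<le> g n x" for n x by (simp add: g_def)
  have g_meas [measurable]: "g n \<in> borel_measurable borel" for n unfolding g_def by measurable
  have ig: "integrable \<nu> (g n)" "integrable \<mu> (g n)" for n
    using integrable_bounded_borel[OF \<nu> g_meas g] integrable_bounded_borel[OF \<mu> g_meas g] by blast+
  have bound: "(\<integral>x. g n x \<partial>\<nu>) \<le> 2 * ((\<integral>x. (dist x x0)\<^sup>2 \<partial>\<mu>) + K)" for n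
  proof -
    have le: "g n x / 2 \<le> inf_conv 1 (g n) x" for x
    proof (rule inf_conv_greatest)
      fix y
      have "(dist x x0)\<^sup>2 \<le> (dist x y + dist y x0)\<^sup>2" by (intro power_mono dist_triangle) simp
      also have "\<dots> \<le> 2 * ((dist x y)\<^sup>2 + (dist y x0)\<^sup>2)"
        using zero_le_power2[of "dist x y - dist y x0"] by (simp add: power2_eq_square algebra_simps)
      finally show "g n x / 2 \<le> g n y + 1 * (dist x y)\<^sup>2"
        \<comment> \<open>If the truncation is active at \<open>y\<close>, the right-hand side is at
          least \<open>n\<close>, while the left-hand side is at most \<open>n / 2\<close>.\<close>
        by (simp add: g_def min_def) (use zero_le_power2[of "dist x y"] of_nat_0_le_iff[of n] in linarith)
    qed
    have "(\<integral>x. g n x / 2 \<partial>\<nu>) \<le> (\<integral>x. inf_conv 1 (g n) x \<partial>\<nu>)"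
    proof (rule integral_mono[OF _ _ le])
      show "integrable \<nu> (inf_conv 1 (g n))"
        using \<nu> by (rule integrable_bounded_borel)
          (use inf_conv_measurable[of "g n" n 1] inf_conv_bounded[of "g n" n 1] g in auto)
    qed (use ig in simp)
    also have "\<dots> \<le> (\<integral>x. g n x \<partial>\<mu>) + K" using g_meas g by (rule dual)
    also have "(\<integral>x. g n x \<partial>\<mu>) \<le> (\<integral>x. (dist x x0)\<^sup>2 \<partial>\<mu>)"
      by (rule integral_mono[OF ig(2) int]) (simp add: g_def)
    finally show ?thesis by simp
  qed
  have "(\<integral>\<^sup>+x. ennreal ((dist x x0)\<^sup>2) \<partial>\<nu>) = (\<integral>\<^sup>+x. liminf (\<lambda>n. ennreal (g n x)) \<partial>\<nu>)"
  proof (rule nn_integral_cong)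
    fix x
    have "\<forall>\<^sub>F n in sequentially. ennreal (g n x) = ennreal ((dist x x0)\<^sup>2)"
      using eventually_ge_at_top[of "nat \<lceil>(dist x x0)\<^sup>2\<rceil>"]
      by eventually_elim (auto simp: g_def min_def nat_le_iff ceiling_le_iff)
    then have "(\<lambda>n. ennreal (g n x)) \<longlonglongrightarrow> ennreal ((dist x x0)\<^sup>2)" by (rule tendsto_eventually)
    then show "ennreal ((dist x x0)\<^sup>2) = liminf (\<lambda>n. ennreal (g n x))"
      by (simp add: lim_imp_Liminf)
  qed
  also have "\<dots> \<le> liminf (\<lambda>n. \<integral>\<^sup>+x. ennreal (g n x) \<partial>\<nu>)"
    by (rule nn_integral_liminf) measurable
  also have "\<dots> \<le> liminf (\<lambda>n. ennreal (2 * ((\<integral>x. (dist x x0)\<^sup>2 \<partial>\<mu>) + K)))"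
  proof (intro Liminf_mono always_eventually allI)
    show "(\<integral>\<^sup>+x. ennreal (g n x) \<partial>\<nu>) \<le> ennreal (2 * ((\<integral>x. (dist x x0)\<^sup>2 \<partial>\<mu>) + K))" for n
      using ennreal_leI[OF bound[of n]] nn_integral_eq_integral[OF ig(1)[of n]] g0 by simp
  qed
  also have "\<dots> < \<infinity>" by (simp add: Liminf_const)
  finally show ?thesis by (intro integrableI_nonneg) auto
qed

section \<open>From LSI to T2\<close>

theorem satisfies_LSI_imp_T2:
  fixes \<mu> :: "'a::polish_space measure"
  assumes \<mu>: "prob_space \<mu>" "sets \<mu> = sets borel"
    and moment: "(\<integral>\<^sup>+ x. ennreal ((dist x x0)\<^sup>2) \<partial>\<mu>) < \<infinity>"
    and C: "C > 0" and LSI: "satisfies_LSI C \<mu>"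
  shows "satisfies_T2 C \<mu>"
  unfolding satisfies_T2_def
proof (intro allI impI)
  fix \<nu> :: "'a measure" assume "prob_space \<nu> \<and> sets \<nu> = sets borel"
  then have \<nu>: "prob_space \<nu>" "sets \<nu> = sets borel" by auto
  note [measurable_cong] = \<mu>(2)
  show "enn2ereal (transport_cost2 \<nu> \<mu>) \<le> ereal C * rel_entropy \<nu> \<mu>"
  proof (cases "rel_entropy \<nu> \<mu>")
    case (real H)
    have dual: "(\<integral>x. inf_conv 1 f x \<partial>\<nu>) \<le> (\<integral>x. f x \<partial>\<mu>) + C * H"
      if f: "f \<in> borel_measurable borel" "\<And>x. \<bar>f x\<bar> \<le> M" for f M
    proof -
      have [measurable]: "inf_conv 1 f \<in> borel_measurable borel"
        using inf_conv_measurable[of f M 1] f by simp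
      \<comment> \<open>Dividing by \<open>C\<close> matches the exponent of the exponential moment
        at \<open>s = 1\<close>; multiplying back afterwards produces \<open>C * H\<close>.\<close>
      have "(\<integral>x. inf_conv 1 f x / C \<partial>\<nu>) \<le> H + ln (\<integral>x. exp (inf_conv 1 f x / C) \<partial>\<mu>)"
      proof (rule integral_le_rel_entropy[OF \<mu>(1) \<nu>(1) _ real])
        show "\<bar>inf_conv 1 f x / C\<bar> \<le> M / C" for x
          using inf_conv_bounded[of f M 1 x] f C by (simp add: divide_right_mono)
      qed (use \<nu> \<mu> in auto)
      then have "C * (\<integral>x. inf_conv 1 f x / C \<partial>\<nu>) \<le> C * (H + ln (\<integral>x. exp (inf_conv 1 f x / C) \<partial>\<mu>))"
        using C by (intro mult_left_mono) auto
      then show ?thesis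
        using LSI_imp_exp_inf_conv_le[OF \<mu> C LSI f(2,1)] C by (simp add: distrib_left)
    qed
    have int: "integrable \<mu> (\<lambda>x. (dist x x0)\<^sup>2)"
      using moment by (intro integrableI_nonneg) auto
    have le: "transport_cost2 \<nu> \<mu> \<le> ennreal (C * H)"
      using transport_cost2_le[OF \<nu> \<mu> second_moment_finite_of_dual[OF \<nu> \<mu> int dual] int dual] .
    \<comment> \<open>Testing \<open>dual\<close> with the zero function gives
      \<open>0 \<le> C * H\<close>, without which \<open>ennreal (C * H)\<close> could not be read
      back as \<open>ereal (C * H)\<close>.\<close>
    have "inf_conv 1 (\<lambda>_. 0) x = 0" for x :: 'a
      using inf_conv_bounded[of "\<lambda>_. 0" 0 1 x] by simp
    then have "0 \<le> C * H" using dual[of "\<lambda>_. 0" 0] by simp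
    with le have "enn2ereal (transport_cost2 \<nu> \<mu>) \<le> ereal (C * H)"
      by (metis enn2ereal_ennreal less_eq_ennreal.rep_eq)
    then show ?thesis by (simp add: real)
  next
    case PInf
    then show ?thesis using C by simp
  next
    case MInf
    moreover have "rel_entropy \<nu> \<mu> \<noteq> - \<infinity>" by (simp add: rel_entropy_def)
    ultimately show ?thesis by contradiction
  qed
qed

theorem theorem3p4:
  fixes \<mu> :: "'a::polish_space measure" and C :: real
  assumes "prob_space \<mu>" and "sets \<mu> = sets borel"
    and "\<exists>x0. (\<integral>\<^sup>+ x. ennreal ((dist x x0)\<^sup>2) \<partial>\<mu>) < \<infinity>"
    and "\<forall>k::real. \<forall>u v. u \<noteq> v \<longrightarrow>
           emeasure \<mu> {x. (dist x u)\<^sup>2 - (dist x v)\<^sup>2 = k} = 0"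
    and "C > 0"
    and "satisfies_LSI C \<mu>"
  shows "satisfies_T2 (2 * C) \<mu>"
proof -
  obtain x0 where x0: "(\<integral>\<^sup>+ x. ennreal ((dist x x0)\<^sup>2) \<partial>\<mu>) < \<infinity>"
    using assms(3) by blast
  \<comment> \<open>LSI becomes weaker as its constant grows, so the constant-preserving implication
    can be used at \<open>2 * C\<close>.\<close>
  have "satisfies_LSI (2 * C) \<mu>"
    using assms(6) by (rule satisfies_LSI_mono) (use assms(5) in simp)
  then show ?thesis
    using assms(5) by (intro satisfies_LSI_imp_T2[OF assms(1,2) x0]) simp
qed

end
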